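(* For the two-user IM/DD interference channel, the capacity region satisfies $\mathcal{G}\subseteq\mathcal{G}'_{\rm Z}$, where $\mathcal{G}'_{\rm Z}$ is the set of all $(\mathsf{R}_1,\mathsf{R}_2)\in\mathbb{R}_+^2$ such that, for $i,j\in\{1,2\}$, $i\neq j$, $$\mathsf{R}_i\le\overline{\mathsf{C}}(h_{ii}\mathsf{A},\alpha_i),$$ $$\mathsf{R}_1+\mathsf{R}_2\le\overline{\mathsf{C}}\big(h_{ii}\mathsf{A}+h_{ji}\mathsf{A},\alpha''_i\big)-\min\Big\{0,\ \tfrac12\log\Big(\max\Big\{\tfrac{h_{ji}^2}{h_{jj}^2},\ \tfrac{1-h_{ji}^2/h_{jj}^2}{2^{2\overline{\mathsf{C}}(h_{jj}\mathsf{A},\alpha_j)}}\Big\}\Big)\Big\},$$ with $\alpha''_i=\frac{h_{ii}\alpha_i+h_{ji}\alpha_j}{h_{ii}+h_{ji}}$.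
   Context: Two-user IM/DD interference channel: for $i,j\in\{1,2\}$, $i\neq j$, $Y_i=h_{ii}X_i+h_{ji}X_j+Z_i$, with channel gains $h_{kl}\ge0$ (with $h_{jj}>0$ and $h_{ii}+h_{ji}>0$ so that the expressions are defined), noises $Z_1,Z_2\sim\mathcal{N}(0,\sigma^2)$ ($\sigma>0$) i.i.d. over time and independent of inputs; inputs satisfy $X_i\in[0,\mathsf{A}]$ ($\mathsf{A}>0$) and $\mathbb{E}[X_i]\le\alpha_i\mathsf{A}$, $\alpha_i\in(0,1]$. Transmitter $i$ encodes $m_i\in\{1,\dots,\lceil2^{n\mathsf{R}_i}\rceil\}$ into a length-$n$ codeword satisfying these constraints; receiver $i$ decodes $m_i$ from $Y_i^n$; $(\mathsf{R}_1,\mathsf{R}_2)$ is achievable if both average error probabilities tend to $0$; $\mathcal{G}$ is the closure of achievable pairs. Logs base 2, $\mathcal{Q}(x)=\int_x^\infty\frac{1}{\sqrt{2\pi}}e^{-t^2/2}dt$. $\overline{\mathsf{C}}(\mathsf{A},\alpha)=c_1$ if $\alpha\in(0,\frac12)$, $=c_2$ if $\alpha\in[\frac12,1]$, where $$c_1=\min_{\mu,\xi>0}\Big[1-\mathcal{Q}\big(\tfrac{\xi+\alpha\mathsf{A}}{\sigma}\big)-\mathcal{Q}\big(\tfrac{\xi+(1-\alpha)\mathsf{A}}{\sigma}\big)\Big]\log\Big(\frac{\mathsf{A}}{\sigma}\frac{e^{\mu\xi/\mathsf{A}}-e^{-\mu(1+\xi/\mathsf{A})}}{\sqrt{2\pi}\mu(1-2\mathcal{Q}(\xi/\sigma))}\Big)+\log(e)\Big[-\tfrac12+\mathcal{Q}\big(\tfrac{\xi}{\sigma}\big)+\tfrac{\xi}{\sqrt{2\pi}\sigma}e^{-\frac{\xi^2}{2\sigma^2}}+\tfrac{\sigma}{\mathsf{A}}\tfrac{\mu}{\sqrt{2\pi}}\big(e^{-\frac{\xi^2}{2\sigma^2}}-e^{-\frac{(\mathsf{A}+\xi)^2}{2\sigma^2}}\big)+\mu\alpha\big(1-2\mathcal{Q}\big(\tfrac{\xi+\mathsf{A}/2}{\sigma}\big)\big)\Big],$$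 $$c_2=\min_{\xi>0}\Big[1-2\mathcal{Q}\big(\tfrac{\xi+\mathsf{A}/2}{\sigma}\big)\Big]\log\Big(\frac{\mathsf{A}+2\xi}{\sigma\sqrt{2\pi}(1-2\mathcal{Q}(\xi/\sigma))}\Big)+\log(e)\Big[-\tfrac12+\mathcal{Q}\big(\tfrac{\xi}{\sigma}\big)+\tfrac{\xi}{\sqrt{2\pi}\sigma}e^{-\frac{\xi^2}{2\sigma^2}}\Big].$$ (It is an upper bound on $\sup\mathsf{I}(X;X+Z)$ over $X\in[0,\mathsf{A}]$ with $\mathbb{E}[X]\le\alpha\mathsf{A}$, $Z\sim\mathcal{N}(0,\sigma^2)$.) *)

theory Defs
  imports "HOL-Probability.Probability"
begin

definition Qfun :: "real \<Rightarrow> real" where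
  "Qfun x = (LBINT t:{x..}. exp (- (t^2) / 2) / sqrt (2 * pi))"

text \<open>c_1 (case alpha < 1/2); first argument is the peak amplitude, last the noise std.\<close>
definition c1_bound :: "real \<Rightarrow> real \<Rightarrow> real \<Rightarrow> real" where
  "c1_bound a \<alpha> \<sigma> = (INF p \<in> {p :: real \<times> real. fst p > 0 \<and> snd p > 0}.
     (let \<mu> = fst p; \<xi> = snd p in
       (1 - Qfun ((\<xi> + \<alpha> * a) / \<sigma>) - Qfun ((\<xi> + (1 - \<alpha>) * a) / \<sigma>))
         * log 2 ((a / \<sigma>) * (exp (\<mu> * \<xi> / a) - exp (- \<mu> * (1 + \<xi> / a)))
                  / (sqrt (2 * pi) * \<mu> * (1 - 2 * Qfun (\<xi> / \<sigma>))))
       + log 2 (exp 1) *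
         (- 1/2 + Qfun (\<xi> / \<sigma>)
          + \<xi> / (sqrt (2 * pi) * \<sigma>) * exp (- (\<xi>^2) / (2 * \<sigma>^2))
          + (\<sigma> / a) * (\<mu> / sqrt (2 * pi))
              * (exp (- (\<xi>^2) / (2 * \<sigma>^2)) - exp (- ((a + \<xi>)^2) / (2 * \<sigma>^2)))
          + \<mu> * \<alpha> * (1 - 2 * Qfun ((\<xi> + a / 2) / \<sigma>)))))"

definition c2_bound :: "real \<Rightarrow> real \<Rightarrow> real" where
  "c2_bound a \<sigma> = (INF \<xi> \<in> {0<..}.
       (1 - 2 * Qfun ((\<xi> + a / 2) / \<sigma>))
         * log 2 ((a + 2 * \<xi>) / (\<sigma> * sqrt (2 * pi) * (1 - 2 * Qfun (\<xi> / \<sigma>))))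
       + log 2 (exp 1) *
         (- 1/2 + Qfun (\<xi> / \<sigma>)
          + \<xi> / (sqrt (2 * pi) * \<sigma>) * exp (- (\<xi>^2) / (2 * \<sigma>^2))))"

definition Cbar :: "real \<Rightarrow> real \<Rightarrow> real \<Rightarrow> real" where
  "Cbar a \<alpha> \<sigma> = (if \<alpha> < 1/2 then c1_bound a \<alpha> \<sigma> else c2_bound a \<sigma>)"

definition nmsg :: "nat \<Rightarrow> real \<Rightarrow> nat" where
  "nmsg n R = nat \<lceil>2 powr (real n * R)\<rceil>"

definition noise :: "nat \<Rightarrow> real \<Rightarrow> (nat \<Rightarrow> real) measure" where
  "noise n \<sigma> = PiM {..<n} (\<lambda>_. density lborel (normal_density 0 \<sigma>))"

definition enc_ok :: "nat \<Rightarrow> nat \<Rightarrow> real \<Rightarrow> real \<Rightarrow> (nat \<Rightarrow> nat \<Rightarrow> real) \<Rightarrow> bool" where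
  "enc_ok n M A \<alpha> f \<longleftrightarrow>
     (\<forall>m\<in>{1..M}. (\<forall>k<n. 0 \<le> f m k \<and> f m k \<le> A) \<and> (\<Sum>k<n. f m k) \<le> real n * \<alpha> * A)"

definition dec_ok :: "nat \<Rightarrow> ((nat \<Rightarrow> real) \<Rightarrow> nat) \<Rightarrow> bool" where
  "dec_ok n g \<longleftrightarrow> g \<in> measurable (PiM {..<n} (\<lambda>_. borel)) (count_space UNIV)"

definition err_prob ::
  "nat \<Rightarrow> real \<Rightarrow> nat \<Rightarrow> nat \<Rightarrow> real \<Rightarrow> real \<Rightarrow> (nat \<Rightarrow> nat \<Rightarrow> real) \<Rightarrow> (nat \<Rightarrow> nat \<Rightarrow> real)
    \<Rightarrow> ((nat \<Rightarrow> real) \<Rightarrow> nat) \<Rightarrow> real" where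
  "err_prob n \<sigma> M M' a b f f' g =
     (\<Sum>m\<in>{1..M}. \<Sum>m'\<in>{1..M'}.
        measure (noise n \<sigma>)
          {z \<in> space (noise n \<sigma>). g (\<lambda>k\<in>{..<n}. a * f m k + b * f' m' k + z k) \<noteq> m})
     / (real M * real M')"

text \<open>Achievability: Y1 = h11 X1 + h21 X2 + Z1, Y2 = h22 X2 + h12 X1 + Z2.\<close>
definition achievable ::
  "real \<Rightarrow> real \<Rightarrow> real \<Rightarrow> real \<Rightarrow> real \<Rightarrow> real \<Rightarrow> real \<Rightarrow> real \<Rightarrow> real \<Rightarrow> real \<Rightarrow> bool" where
  "achievable h11 h12 h21 h22 \<sigma> A \<alpha>1 \<alpha>2 R1 R2 \<longleftrightarrow>
     R1 \<ge> 0 \<and> R2 \<ge> 0 \<and>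
     (\<exists>(f1 :: nat \<Rightarrow> nat \<Rightarrow> nat \<Rightarrow> real) (f2 :: nat \<Rightarrow> nat \<Rightarrow> nat \<Rightarrow> real)
        (g1 :: nat \<Rightarrow> (nat \<Rightarrow> real) \<Rightarrow> nat) (g2 :: nat \<Rightarrow> (nat \<Rightarrow> real) \<Rightarrow> nat).
        (\<forall>n. enc_ok n (nmsg n R1) A \<alpha>1 (f1 n) \<and> enc_ok n (nmsg n R2) A \<alpha>2 (f2 n)
             \<and> dec_ok n (g1 n) \<and> dec_ok n (g2 n)) \<and>
        (\<lambda>n. err_prob n \<sigma> (nmsg n R1) (nmsg n R2) h11 h21 (f1 n) (f2 n) (g1 n)) \<longlonglongrightarrow> 0 \<and>
        (\<lambda>n. err_prob n \<sigma> (nmsg n R2) (nmsg n R1) h22 h12 (f2 n) (f1 n) (g2 n)) \<longlonglongrightarrow> 0)"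

definition capacity_region ::
  "real \<Rightarrow> real \<Rightarrow> real \<Rightarrow> real \<Rightarrow> real \<Rightarrow> real \<Rightarrow> real \<Rightarrow> real \<Rightarrow> (real \<times> real) set" where
  "capacity_region h11 h12 h21 h22 \<sigma> A \<alpha>1 \<alpha>2 =
     closure {(R1, R2). achievable h11 h12 h21 h22 \<sigma> A \<alpha>1 \<alpha>2 R1 R2}"

text \<open>Sum-rate bound for receiver i (hii, hji = gain of interferer j at receiver i,
  hjj, alpha_i, alpha_j).\<close>
definition sum_bound :: "real \<Rightarrow> real \<Rightarrow> real \<Rightarrow> real \<Rightarrow> real \<Rightarrow> real \<Rightarrow> real \<Rightarrow> real" where
  "sum_bound \<sigma> A hii hji hjj \<alpha>i \<alpha>j =
     Cbar (hii * A + hji * A) ((hii * \<alpha>i + hji * \<alpha>j) / (hii + hji)) \<sigma>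
     - min 0 (1/2 * log 2 (max (hji^2 / hjj^2)
                                ((1 - hji^2 / hjj^2) / 2 powr (2 * Cbar (hjj * A) \<alpha>j \<sigma>))))"

definition GZ' ::
  "real \<Rightarrow> real \<Rightarrow> real \<Rightarrow> real \<Rightarrow> real \<Rightarrow> real \<Rightarrow> real \<Rightarrow> real \<Rightarrow> (real \<times> real) set" where
  "GZ' h11 h12 h21 h22 \<sigma> A \<alpha>1 \<alpha>2 = {(R1, R2). R1 \<ge> 0 \<and> R2 \<ge> 0 \<and>
      R1 \<le> Cbar (h11 * A) \<alpha>1 \<sigma> \<and> R2 \<le> Cbar (h22 * A) \<alpha>2 \<sigma> \<and>
      R1 + R2 \<le> sum_bound \<sigma> A h11 h21 h22 \<alpha>1 \<alpha>2 \<and>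
      R1 + R2 \<le> sum_bound \<sigma> A h22 h12 h11 \<alpha>2 \<alpha>1}"

end

(* The bound Cbar is a duality bound: the divergence of N(x, sigma^2) from a test density with
   Gaussian tails and a truncated exponential in the middle is at most K + c (x - mean), and K is
   the expression minimised in Cbar. Summed over a codebook this bounds its rate.

   For the sum rate with r = h21 / h22, a receiver whose noise is reduced by the factor min 1 r can
   decode both messages: it simulates each receiver by adding independent noise. The reduction
   raises the divergence only by -log (min 1 r), which gives the first term of the maximum. The
   second one already follows from R1 <= Cbar (sum) and R2 <= Cbar (h22 A), since the
   factor 1 - r^2 only weakens the bound; no entropy power inequality is needed. *)

theory Submission
  imports Defs
begin

section \<open>A converse from divergence bounds\<close>

text \<open>Decoders here are deterministic, so the noise added in the simulation is made part of
  the observation: the strong receiver sees \<open>x + a U\<close> together with \<open>V\<close>,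
  and \<open>a U + b V\<close> has the law of the original noise once
  \<open>a\<^sup>2 + b\<^sup>2 = 1\<close>. The noises simulated for the two receivers share
  \<open>U\<close> and \<open>V\<close> and are dependent. This is harmless: each error probability
  involves one receiver only, and a union bound joins them. After subtraction of
  \<open>h11 X1\<close> the second signal has the right strength relative to its noise only if
  \<open>c h21 = a h22\<close>. With \<open>a, c \<le> 1\<close> the largest possible
  \<open>a\<close> is \<open>min 1 r\<close>, and \<open>- ln a\<close> is the whole price. Every
  codeword's output law is compared with one fixed product law, so no input distribution has to be
  optimised; the mean constraint on the codeword makes its multiplier terms sum to something
  nonpositive. Each admissible parameter of \<open>Cbar\<close> gives a bound of its own, so the
  bounds pass to the infimum whether or not it is attained. For \<open>h21 = 0\<close> no positive
  \<open>a\<close> is available; there the second term of the maximum takes over.\<close>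

lemma PiM_density:
  fixes \<rho> :: "'i \<Rightarrow> 'a \<Rightarrow> ennreal"
  assumes K: "finite K" and Q: "prob_space Q"
    and [measurable]: "\<And>k. \<rho> k \<in> borel_measurable Q"
    and P: "\<And>k. prob_space (density Q (\<rho> k))"
  shows "PiM K (\<lambda>k. density Q (\<rho> k)) = density (PiM K (\<lambda>_. Q)) (\<lambda>\<omega>. \<Prod>k\<in>K. \<rho> k (\<omega> k))"
proof -
  interpret Q: product_sigma_finite "\<lambda>_::'i. Q"
    using Q by (simp add: product_sigma_finite_def prob_space_imp_sigma_finite)
  interpret P: product_sigma_finite "\<lambda>k. density Q (\<rho> k)"
    using P by (simp add: product_sigma_finite_def prob_space_imp_sigma_finite)
  show ?thesis
  proof (rule P.PiM_eqI[symmetric])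
    fix A assume A: "\<And>i. i \<in> K \<Longrightarrow> A i \<in> sets (density Q (\<rho> i))"
    then have A'[measurable]: "\<And>i. i \<in> K \<Longrightarrow> A i \<in> sets Q" by simp
    have "emeasure (density (PiM K (\<lambda>_. Q)) (\<lambda>\<omega>. \<Prod>k\<in>K. \<rho> k (\<omega> k))) (Pi\<^sub>E K A)
        = (\<integral>\<^sup>+\<omega>. (\<Prod>k\<in>K. \<rho> k (\<omega> k)) * indicator (Pi\<^sub>E K A) \<omega> \<partial>PiM K (\<lambda>_. Q))"
      using K by (intro emeasure_density) (auto intro!: sets_PiM_I_finite)
    also have "\<dots> = (\<integral>\<^sup>+\<omega>. (\<Prod>k\<in>K. \<rho> k (\<omega> k) * indicator (A k) (\<omega> k)) \<partial>PiM K (\<lambda>_. Q))"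
    proof (rule nn_integral_cong)
      fix \<omega> assume "\<omega> \<in> space (PiM K (\<lambda>_. Q))"
      then have "\<omega> \<in> Pi\<^sub>E K A \<longleftrightarrow> (\<forall>k\<in>K. \<omega> k \<in> A k)"
        by (auto simp: space_PiM PiE_iff)
      then have "indicator (Pi\<^sub>E K A) \<omega> = (\<Prod>k\<in>K. indicator (A k) (\<omega> k) :: ennreal)"
        using K by (auto simp: indicator_def intro: prod_zero)
      then show "(\<Prod>k\<in>K. \<rho> k (\<omega> k)) * indicator (Pi\<^sub>E K A) \<omega>
          = (\<Prod>k\<in>K. \<rho> k (\<omega> k) * indicator (A k) (\<omega> k))"
        by (simp add: prod.distrib)
    qed
    also have "\<dots> = (\<Prod>k\<in>K. \<integral>\<^sup>+y. \<rho> k y * indicator (A k) y \<partial>Q)"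
      using K by (intro Q.product_nn_integral_prod) auto
    also have "\<dots> = (\<Prod>k\<in>K. emeasure (density Q (\<rho> k)) (A k))"
      by (intro prod.cong refl) (simp add: emeasure_density)
    finally show "emeasure (density (PiM K (\<lambda>_. Q)) (\<lambda>\<omega>. \<Prod>k\<in>K. \<rho> k (\<omega> k))) (Pi\<^sub>E K A) = \<dots>" .
  qed (use K in \<open>auto cong: sets_PiM_cong\<close>)
qed

text \<open>Integrate \<open>ln t \<le> t - 1\<close> for \<open>t = g / \<rho>\<close> against the \<open>i\<close>-th output law, where \<open>g\<close> is \<open>card I\<close> on
  the decoding region \<open>B i\<close> and \<open>1\<close> elsewhere: this is Fano's inequality without entropies.\<close>

lemma duality_converse:
  fixes \<rho> :: "'i \<Rightarrow> 'k \<Rightarrow> 'a \<Rightarrow> real"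
  assumes K: "finite K" and I: "finite I" "I \<noteq> {}" and Q: "prob_space Q"
    and m[measurable]: "\<And>i k. \<rho> i k \<in> borel_measurable Q"
    and pos: "\<And>i k y. \<rho> i k y > 0"
    and P: "\<And>i k. prob_space (density Q (\<rho> i k))"
    and int: "\<And>i k. integrable (density Q (\<rho> i k)) (\<lambda>y. ln (\<rho> i k y))"
    and B[measurable]: "\<And>i. i \<in> I \<Longrightarrow> B i \<in> sets (PiM K (\<lambda>_. Q))"
    and disj: "disjoint_family_on B I"
  shows "(\<Sum>i\<in>I. measure (PiM K (\<lambda>k. density Q (\<rho> i k))) (B i)) * ln (card I)
    \<le> (\<Sum>i\<in>I. \<Sum>k\<in>K. \<integral>y. ln (\<rho> i k y) \<partial>density Q (\<rho> i k)) + card I"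
proof -
  let ?Q = "PiM K (\<lambda>_. Q)"
  let ?P = "\<lambda>i. PiM K (\<lambda>k. density Q (\<rho> i k))"
  let ?r = "\<lambda>i \<omega>. \<Prod>k\<in>K. \<rho> i k (\<omega> k)"
  define M where "M = real (card I)"
  have M: "M \<ge> 1" using I by (simp add: M_def Suc_le_eq card_gt_0_iff)
  interpret Q: prob_space ?Q using Q by (intro prob_space_PiM)
  have rpos: "?r i \<omega> > 0" for i \<omega> by (intro prod_pos) (simp add: pos)
  have each: "measure (?P i) (B i) * ln M - (\<Sum>k\<in>K. \<integral>y. ln (\<rho> i k y) \<partial>density Q (\<rho> i k))
     \<le> M * measure ?Q (B i)" if i: "i \<in> I" for i
  proof -
    interpret P: prob_space "?P i" using P by (intro prob_space_PiM)
    have [measurable]: "B i \<in> sets ?Q" using B i by simp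
    have sP: "sets (?P i) = sets ?Q" by (intro sets_PiM_cong) auto
    have Bp: "B i \<in> sets (?P i)" using sP by simp
    have Pd: "?P i = density ?Q (\<lambda>\<omega>. ennreal (?r i \<omega>))"
      using PiM_density[OF K Q, of "\<lambda>k y. ennreal (\<rho> i k y)"] P
      by (simp add: prod_ennreal less_imp_le[OF pos])
    let ?g = "\<lambda>\<omega>. if \<omega> \<in> B i then M else 1"
    have int_k: "integrable (?P i) (\<lambda>\<omega>. ln (\<rho> i k (\<omega> k)))"
      and eq_k: "(\<integral>\<omega>. ln (\<rho> i k (\<omega> k)) \<partial>?P i) = (\<integral>y. ln (\<rho> i k y) \<partial>density Q (\<rho> i k))" if "k \<in> K" for k
    proof -
      have d: "distr (?P i) (density Q (\<rho> i k)) (\<lambda>\<omega>. \<omega> k) = density Q (\<rho> i k)"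
        using P that by (intro distr_PiM_component)
      have mk[measurable]: "(\<lambda>\<omega>. \<omega> k) \<in> measurable (?P i) (density Q (\<rho> i k))"
        using that by (intro measurable_component_singleton)
      have "integrable (distr (?P i) (density Q (\<rho> i k)) (\<lambda>\<omega>. \<omega> k)) (\<lambda>y. ln (\<rho> i k y))"
        unfolding d by (rule int)
      then show "integrable (?P i) (\<lambda>\<omega>. ln (\<rho> i k (\<omega> k)))"
        by (rule integrable_distr[OF mk])
      have "(\<integral>y. ln (\<rho> i k y) \<partial>distr (?P i) (density Q (\<rho> i k)) (\<lambda>\<omega>. \<omega> k)) = (\<integral>\<omega>. ln (\<rho> i k (\<omega> k)) \<partial>?P i)"
        by (rule integral_distr[OF mk]) simp
      then show "(\<integral>\<omega>. ln (\<rho> i k (\<omega> k)) \<partial>?P i) = (\<integral>y. ln (\<rho> i k y) \<partial>density Q (\<rho> i k))"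
        unfolding d by simp
    qed
    have int1: "integrable ?Q ?g"
      by (rule Q.integrable_const_bound[of _ M]) (use M in auto)
    have [measurable]: "(\<lambda>\<omega>. ?g \<omega> / ?r i \<omega>) \<in> borel_measurable ?Q" by measurable
    have eqg: "(\<lambda>\<omega>. ?r i \<omega> *\<^sub>R (?g \<omega> / ?r i \<omega>)) = ?g"
      using rpos[of i] by (auto simp: fun_eq_iff less_le)
    have int2: "integrable (?P i) (\<lambda>\<omega>. ?g \<omega> / ?r i \<omega>)"
      unfolding Pd by (subst integrable_density) (use rpos int1 eqg in \<open>auto simp: less_imp_le\<close>)
    have int3: "integrable (?P i) (\<lambda>\<omega>. indicator (B i) \<omega> * ln M)"
      using Bp by (intro integrable_mult_left integrable_real_indicator) (auto simp: P.emeasure_eq_measure)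
    have pt: "indicator (B i) \<omega> * ln M - (\<Sum>k\<in>K. ln (\<rho> i k (\<omega> k))) \<le> ?g \<omega> / ?r i \<omega> - 1" for \<omega>
    proof -
      have "ln (?g \<omega> / ?r i \<omega>) \<le> ?g \<omega> / ?r i \<omega> - 1"
        using M rpos[of i \<omega>] by (intro ln_le_minus_one) auto
      moreover have "ln (?g \<omega> / ?r i \<omega>) = ln (?g \<omega>) - ln (?r i \<omega>)"
        using M rpos[of i \<omega>] by (subst ln_div) auto
      moreover have "ln (?r i \<omega>) = (\<Sum>k\<in>K. ln (\<rho> i k (\<omega> k)))"
        using K pos by (subst ln_prod) (auto, metis less_irrefl)
      ultimately show ?thesis by (auto simp: indicator_def split: if_splits)
    qed
    have "(\<integral>\<omega>. indicator (B i) \<omega> * ln M - (\<Sum>k\<in>K. ln (\<rho> i k (\<omega> k))) \<partial>?P i)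
        \<le> (\<integral>\<omega>. ?g \<omega> / ?r i \<omega> - 1 \<partial>?P i)"
      using int2 int3 int_k pt by (intro integral_mono) auto
    also have "\<dots> = (\<integral>\<omega>. ?g \<omega> / ?r i \<omega> \<partial>?P i) - 1"
      using int2 by (subst Bochner_Integration.integral_diff) (auto simp: P.prob_space)
    also have "(\<integral>\<omega>. ?g \<omega> / ?r i \<omega> \<partial>?P i) = (\<integral>\<omega>. ?g \<omega> \<partial>?Q)"
      unfolding Pd by (subst integral_density) (use rpos eqg in \<open>auto simp: less_imp_le\<close>)
    also have "\<dots> = (\<integral>\<omega>. 1 + (M - 1) * indicator (B i) \<omega> \<partial>?Q)"
      by (intro Bochner_Integration.integral_cong) (auto simp: indicator_def)
    also have "\<dots> = 1 + (M - 1) * measure ?Q (B i)"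
      by (subst Bochner_Integration.integral_add) (auto simp: Q.prob_space Q.emeasure_eq_measure)
    finally have "(\<integral>\<omega>. indicator (B i) \<omega> * ln M - (\<Sum>k\<in>K. ln (\<rho> i k (\<omega> k))) \<partial>?P i)
        \<le> M * measure ?Q (B i)"
      by (simp add: algebra_simps) (smt (verit) measure_nonneg)
    also have "(\<integral>\<omega>. indicator (B i) \<omega> * ln M - (\<Sum>k\<in>K. ln (\<rho> i k (\<omega> k))) \<partial>?P i)
       = measure (?P i) (B i) * ln M - (\<Sum>k\<in>K. \<integral>y. ln (\<rho> i k y) \<partial>density Q (\<rho> i k))"
      using int3 int_k Bp sets.sets_into_space[OF Bp]
      by (subst Bochner_Integration.integral_diff) (auto simp: eq_k Int_absorb2)
    finally show ?thesis .
  qed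
  \<comment> \<open>All regions are measured by the same law \<open>?Q\<close> and are disjoint, so
    their masses add up to at most 1. The right-hand sides of \<open>each\<close> therefore add up
    to at most \<open>card I\<close>, the additive term of the claim.\<close>
  have "(\<Sum>i\<in>I. measure ?Q (B i)) = measure ?Q (\<Union>i\<in>I. B i)"
    using I disj B by (subst Q.finite_measure_finite_Union) auto
  then have "(\<Sum>i\<in>I. measure ?Q (B i)) \<le> 1" by simp
  then have "M * (\<Sum>i\<in>I. measure ?Q (B i)) \<le> M"
    using M by (simp add: mult_le_cancel_left1)
  moreover have "(\<Sum>i\<in>I. measure (?P i) (B i) * ln M - (\<Sum>k\<in>K. \<integral>y. ln (\<rho> i k y) \<partial>density Q (\<rho> i k)))
     \<le> M * (\<Sum>i\<in>I. measure ?Q (B i))"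
    unfolding sum_distrib_left by (intro sum_mono each)
  ultimately show ?thesis
    by (simp add: sum_subtractf sum_distrib_right M_def)
qed

section \<open>Gaussian noise\<close>

text \<open>The map may differ from coordinate to coordinate, as it does when the noise is shifted
  by a codeword.\<close>

lemma distr_PiM_componentwise:
  fixes f :: "'i \<Rightarrow> 'a \<Rightarrow> 'b"
  assumes K: "finite K" and M: "\<And>k. prob_space (M k)"
    and f[measurable]: "\<And>k. f k \<in> measurable (M k) (N k)"
  shows "distr (PiM K M) (PiM K N) (\<lambda>\<omega>. \<lambda>k\<in>K. f k (\<omega> k)) = PiM K (\<lambda>k. distr (M k) (N k) (f k))"
proof -
  interpret M: product_sigma_finite M
    using M by (simp add: product_sigma_finite_def prob_space_imp_sigma_finite)
  interpret D: product_sigma_finite "\<lambda>k. distr (M k) (N k) (f k)"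
    using prob_space.prob_space_distr[OF M f]
    by (simp add: product_sigma_finite_def prob_space_imp_sigma_finite)
  show ?thesis
  proof (rule D.PiM_eqI)
    fix A assume A: "\<And>i. i \<in> K \<Longrightarrow> A i \<in> sets (distr (M i) (N i) (f i))"
    then have A'[measurable]: "\<And>i. i \<in> K \<Longrightarrow> A i \<in> sets (N i)" by simp
    have "emeasure (distr (PiM K M) (PiM K N) (\<lambda>\<omega>. \<lambda>k\<in>K. f k (\<omega> k))) (Pi\<^sub>E K A)
      = emeasure (PiM K M) ((\<lambda>\<omega>. \<lambda>k\<in>K. f k (\<omega> k)) -` Pi\<^sub>E K A \<inter> space (PiM K M))"
      using K by (intro emeasure_distr) (auto intro!: sets_PiM_I_finite)
    also have "(\<lambda>\<omega>. \<lambda>k\<in>K. f k (\<omega> k)) -` Pi\<^sub>E K A \<inter> space (PiM K M)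
      = Pi\<^sub>E K (\<lambda>k. f k -` A k \<inter> space (M k))"
      by (auto simp: space_PiM PiE_iff extensional_def)
    also have "emeasure (PiM K M) \<dots> = (\<Prod>k\<in>K. emeasure (M k) (f k -` A k \<inter> space (M k)))"
      using K by (intro M.emeasure_PiM) auto
    also have "\<dots> = (\<Prod>k\<in>K. emeasure (distr (M k) (N k) (f k)) (A k))"
      by (intro prod.cong refl) (simp add: emeasure_distr)
    finally show "emeasure (distr (PiM K M) (PiM K N) (\<lambda>\<omega>. \<lambda>k\<in>K. f k (\<omega> k))) (Pi\<^sub>E K A) = \<dots>" .
  qed (use K in \<open>auto cong: sets_PiM_cong\<close>)
qed

definition gauss :: "real \<Rightarrow> real measure" where
  "gauss \<sigma> = density lborel (normal_density 0 \<sigma>)"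

lemma sets_gauss[simp, measurable_cong]: "sets (gauss \<sigma>) = sets borel"
  by (simp add: gauss_def)

lemma space_gauss[simp]: "space (gauss \<sigma>) = UNIV"
  by (simp add: gauss_def)

lemma prob_space_gauss: "\<sigma> > 0 \<Longrightarrow> prob_space (gauss \<sigma>)"
  unfolding gauss_def by (rule prob_space_normal_density)

lemma distr_gauss_affine:
  assumes "\<sigma> > 0" "a > 0"
  shows "distr (gauss \<sigma>) lborel (\<lambda>u. x + a * u) = density lborel (normal_density x (a * \<sigma>))"
proof -
  interpret prob_space "gauss \<sigma>" using assms by (intro prob_space_gauss)
  have "distributed (gauss \<sigma>) lborel (\<lambda>u. u) (normal_density 0 \<sigma>)"
    unfolding distributed_def by (auto simp: gauss_def distr_id2)
  from normal_density_affine[OF this assms(1), of a x] assms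
  have "distributed (gauss \<sigma>) lborel (\<lambda>u. x + a * u) (normal_density x (a * \<sigma>))" by simp
  then show ?thesis unfolding distributed_def by simp
qed

text \<open>Rotation invariance: the combination is Gaussian with variance \<open>a\<^sup>2
  \<sigma>\<^sup>2 + b\<^sup>2 \<sigma>\<^sup>2 = \<sigma>\<^sup>2\<close>. This lets a receiver
  with noise \<open>a U\<close> recreate the original noise by adding \<open>b V\<close>.\<close>

lemma distr_gauss_rotate:
  assumes \<sigma>: "\<sigma> > 0" and a: "a > 0" and ab: "a\<^sup>2 + b\<^sup>2 = 1"
  shows "distr (gauss \<sigma> \<Otimes>\<^sub>M gauss \<sigma>) (gauss \<sigma>) (\<lambda>(u, v). a * u + b * v) = gauss \<sigma>"
proof -
  let ?G = "gauss \<sigma>"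
  interpret G: prob_space ?G using \<sigma> by (rule prob_space_gauss)
  interpret GG: pair_prob_space ?G ?G ..
  have fstd: "distr (?G \<Otimes>\<^sub>M ?G) lborel fst = ?G"
  proof -
    have "distr (?G \<Otimes>\<^sub>M ?G) lborel fst = distr (?G \<Otimes>\<^sub>M ?G) ?G fst"
      by (intro distr_cong) auto
    also have "\<dots> = ?G" by (rule G.distr_pair_fst)
    finally show ?thesis .
  qed
  have sndd: "distr (?G \<Otimes>\<^sub>M ?G) lborel snd = ?G"
  proof -
    have "distr (?G \<Otimes>\<^sub>M ?G) lborel snd = distr (?G \<Otimes>\<^sub>M ?G) ?G snd"
      by (intro distr_cong) auto
    also have "\<dots> = ?G"
    proof (rule measure_eqI)
      fix A assume "A \<in> sets (distr (?G \<Otimes>\<^sub>M ?G) ?G snd)"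
      then have A: "A \<in> sets ?G" by simp
      have "emeasure (distr (?G \<Otimes>\<^sub>M ?G) ?G snd) A = emeasure (?G \<Otimes>\<^sub>M ?G) (UNIV \<times> A)"
        using A by (subst emeasure_distr[OF measurable_snd])
          (auto simp: space_pair_measure intro!: arg_cong2[where f=emeasure])
      also have "\<dots> = emeasure ?G UNIV * emeasure ?G A"
        using A by (intro G.emeasure_pair_measure_Times) auto
      finally show "emeasure (distr (?G \<Otimes>\<^sub>M ?G) ?G snd) A = emeasure ?G A"
        using G.emeasure_space_1 by simp
    qed simp
    finally show ?thesis .
  qed
  have df: "distributed (?G \<Otimes>\<^sub>M ?G) lborel fst (normal_density 0 \<sigma>)"
    unfolding distributed_def fstd by (auto simp: gauss_def)
  have ds: "distributed (?G \<Otimes>\<^sub>M ?G) lborel snd (normal_density 0 \<sigma>)"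
    unfolding distributed_def sndd by (auto simp: gauss_def)
  have ind: "GG.indep_var borel fst borel snd"
    unfolding GG.indep_var_distribution_eq
  proof (intro conjI)
    have "distr (?G \<Otimes>\<^sub>M ?G) borel fst = ?G" "distr (?G \<Otimes>\<^sub>M ?G) borel snd = ?G"
      using fstd sndd by (simp_all cong: distr_cong)
    moreover have "distr (?G \<Otimes>\<^sub>M ?G) (borel \<Otimes>\<^sub>M borel) (\<lambda>w. (fst w, snd w)) = ?G \<Otimes>\<^sub>M ?G"
      by (simp add: distr_id2 cong: sets_pair_measure_cong)
    ultimately show "distr (?G \<Otimes>\<^sub>M ?G) borel fst \<Otimes>\<^sub>M distr (?G \<Otimes>\<^sub>M ?G) borel snd
        = distr (?G \<Otimes>\<^sub>M ?G) (borel \<Otimes>\<^sub>M borel) (\<lambda>w. (fst w, snd w))" by simp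
  qed simp_all
  have "distributed (?G \<Otimes>\<^sub>M ?G) lborel (\<lambda>w. a * fst w + b * snd w) (normal_density 0 \<sigma>)"
  proof (cases "b = 0")
    \<comment> \<open>For \<open>b = 0\<close> the second summand is constant and has no density, so
      the sum rule for independent normal variables does not apply.\<close>
    case True
    then have "a = 1" using ab a by (simp add: power2_eq_1_iff)
    then show ?thesis using df True by simp
  next
    case False
    have 1: "distributed (?G \<Otimes>\<^sub>M ?G) lborel (\<lambda>w. 0 + a * fst w) (normal_density (0 + a * 0) (\<bar>a\<bar> * \<sigma>))"
      using a by (intro GG.normal_density_affine[OF df \<sigma>]) auto
    have 2: "distributed (?G \<Otimes>\<^sub>M ?G) lborel (\<lambda>w. 0 + b * snd w) (normal_density (0 + b * 0) (\<bar>b\<bar> * \<sigma>))"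
      using False by (intro GG.normal_density_affine[OF ds \<sigma>]) auto
    have "GG.indep_var borel ((\<lambda>u. 0 + a * u) \<circ> fst) borel ((\<lambda>u. 0 + b * u) \<circ> snd)"
      by (rule GG.indep_var_compose[OF ind]) auto
    then have 3: "GG.indep_var borel (\<lambda>w. 0 + a * fst w) borel (\<lambda>w. 0 + b * snd w)"
      by (simp add: comp_def)
    have "sqrt ((\<bar>a\<bar> * \<sigma>)\<^sup>2 + (\<bar>b\<bar> * \<sigma>)\<^sup>2) = sqrt ((a\<^sup>2 + b\<^sup>2) * \<sigma>\<^sup>2)"
      by (simp add: power_mult_distrib algebra_simps)
    also have "\<dots> = \<sigma>" using ab \<sigma> by simp
    finally have s: "sqrt ((\<bar>a\<bar> * \<sigma>)\<^sup>2 + (\<bar>b\<bar> * \<sigma>)\<^sup>2) = \<sigma>" .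
    show ?thesis
      using GG.add_indep_normal[OF 3 _ _ 1 2] a False \<sigma> unfolding s by simp
  qed
  then have "distr (?G \<Otimes>\<^sub>M ?G) lborel (\<lambda>w. a * fst w + b * snd w) = ?G"
    unfolding distributed_def gauss_def by simp
  moreover have "distr (?G \<Otimes>\<^sub>M ?G) lborel (\<lambda>w. a * fst w + b * snd w)
     = distr (?G \<Otimes>\<^sub>M ?G) ?G (\<lambda>(u, v). a * u + b * v)"
    by (intro distr_cong) (auto simp: case_prod_beta)
  ultimately show ?thesis by simp
qed

section \<open>Second moment and log-density of the noise\<close>

lemma integrable_gauss_iff:
  "f \<in> borel_measurable borel \<Longrightarrow> integrable (gauss \<sigma>) f \<longleftrightarrow> integrable lborel (\<lambda>z. normal_density 0 \<sigma> z * f z)"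
  for f :: "real \<Rightarrow> real"
  unfolding gauss_def by (subst integrable_density) (auto simp: normal_density_nonneg)

lemma integral_gauss:
  "f \<in> borel_measurable borel \<Longrightarrow> integral\<^sup>L (gauss \<sigma>) f = (\<integral>z. normal_density 0 \<sigma> z * f z \<partial>lborel)"
  for f :: "real \<Rightarrow> real"
  unfolding gauss_def by (subst integral_density) (auto simp: normal_density_nonneg)

lemma integrable_gauss_square: "\<sigma> > 0 \<Longrightarrow> integrable (gauss \<sigma>) (\<lambda>z. z\<^sup>2)"
  using integrable_normal_moment[of \<sigma> 0 2] by (subst integrable_gauss_iff) auto

lemma integral_gauss_square: "\<sigma> > 0 \<Longrightarrow> (\<integral>z. z\<^sup>2 \<partial>gauss \<sigma>) = \<sigma>\<^sup>2"
  using integral_normal_moment_even[of \<sigma> 0 1] by (subst integral_gauss) auto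

text \<open>At \<open>x + a u\<close> the log-density of the reduced noise differs from that of the
  full noise at \<open>u\<close> only by \<open>- ln a\<close>. The price of the noise reduction
  originates here.\<close>

lemma ln_normal_density_affine:
  assumes "\<sigma> > 0" "a > 0"
  shows "ln (normal_density x (a * \<sigma>) (x + a * u)) = - ln a - ln (\<sigma> * sqrt (2 * pi)) - u\<^sup>2 / (2 * \<sigma>\<^sup>2)"
proof -
  have "normal_density x (a * \<sigma>) (x + a * u) = exp (- (u\<^sup>2 / (2 * \<sigma>\<^sup>2))) / (a * (\<sigma> * sqrt (2 * pi)))"
    using assms by (simp add: normal_density_def real_sqrt_mult power_mult_distrib field_simps)
  also have "ln \<dots> = ln (exp (- (u\<^sup>2 / (2 * \<sigma>\<^sup>2)))) - ln (a * (\<sigma> * sqrt (2 * pi)))"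
    using assms by (subst ln_div) auto
  also have "ln (a * (\<sigma> * sqrt (2 * pi))) = ln a + ln (\<sigma> * sqrt (2 * pi))"
    using assms by (subst ln_mult) auto
  finally show ?thesis by simp
qed

text \<open>The observed pair is \<open>(x + a U, V)\<close> with independent Gaussian \<open>U, V\<close>. Comparing it with the density
  \<open>q (y + b v) \<phi> v\<close> makes the divergence depend only on \<open>x + (a U + b V)\<close>, i.e. on the original channel,
  up to the entropy shift \<open>ln a\<close>.\<close>

lemma gaussian_pair_converse:
  fixes x :: "'i \<Rightarrow> nat \<Rightarrow> real" and q :: "real \<Rightarrow> real"
  assumes \<sigma>: "\<sigma> > 0" and a: "a > 0" and ab: "a\<^sup>2 + b\<^sup>2 = 1"
    and I: "finite I" "I \<noteq> {}"
    and q[measurable]: "q \<in> borel_measurable borel" and qpos: "\<And>y. q y > 0"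
    and q1: "(\<integral>\<^sup>+y. ennreal (q y) \<partial>lborel) = 1"
    and qint: "\<And>x. integrable (gauss \<sigma>) (\<lambda>z. ln (q (x + z)))"
    and B: "\<And>i. i \<in> I \<Longrightarrow> B i \<in> sets (PiM {..<n} (\<lambda>_. borel \<Otimes>\<^sub>M borel))"
    and disj: "disjoint_family_on B I"
  defines "W \<equiv> PiM {..<n} (\<lambda>_. gauss \<sigma> \<Otimes>\<^sub>M gauss \<sigma>)"
  shows "(\<Sum>i\<in>I. measure W {\<omega> \<in> space W. (\<lambda>k\<in>{..<n}. (x i k + a * fst (\<omega> k), snd (\<omega> k))) \<in> B i}) * ln (card I)
    \<le> (\<Sum>i\<in>I. \<Sum>k<n. - 1/2 - ln (\<sigma> * sqrt (2 * pi)) - ln a - (\<integral>z. ln (q (x i k + z)) \<partial>gauss \<sigma>)) + card I"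
proof -
  let ?G = "gauss \<sigma>"
  let ?\<phi> = "normal_density 0 \<sigma>"
  let ?L = "lborel \<Otimes>\<^sub>M lborel :: (real \<times> real) measure"
  define Q where "Q = density ?L (\<lambda>w. ennreal (q (fst w + b * snd w) * ?\<phi> (snd w)))"
  \<comment> \<open>The observed pair has the density of \<open>N(x, (a \<sigma>)\<^sup>2)\<close>
    times \<open>?\<phi>\<close>. The factor \<open>?\<phi>\<close> is shared with the density of
    \<open>Q\<close> and cancels in the quotient.\<close>
  define \<rho> where "\<rho> = (\<lambda>i k w. normal_density (x i k) (a * \<sigma>) (fst w) / q (fst w + b * snd w))"
  let ?T = "\<lambda>t w. (t + a * fst w, snd w)"
  interpret G: prob_space ?G using \<sigma> by (rule prob_space_gauss)
  interpret GG: pair_prob_space ?G ?G ..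
  have sQ[simp, measurable_cong]: "sets Q = sets (borel \<Otimes>\<^sub>M borel)"
    by (simp add: Q_def cong: sets_pair_measure_cong)
  have sGG[simp]: "sets (?G \<Otimes>\<^sub>M ?G) = sets (borel \<Otimes>\<^sub>M borel)"
    by (simp cong: sets_pair_measure_cong)
  have [measurable]: "q \<in> borel_measurable lborel" by simp
  have \<phi>1: "(\<integral>\<^sup>+v. ennreal (?\<phi> v) \<partial>lborel) = 1"
    using \<sigma> by (subst nn_integral_eq_integral) auto
  \<comment> \<open>Integrating over \<open>y\<close> first, the shift by \<open>b v\<close> leaves
    the mass of \<open>q\<close> equal to 1 for every fixed \<open>v\<close>.\<close>
  have "emeasure Q (space Q) = (\<integral>\<^sup>+w. ennreal (q (fst w + b * snd w) * ?\<phi> (snd w)) \<partial>?L)"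
    unfolding Q_def space_density
    by (subst emeasure_density[OF _ sets.top]) (auto intro!: nn_integral_cong)
  also have "\<dots> = (\<integral>\<^sup>+v. \<integral>\<^sup>+y. ennreal (q (y + b * v) * ?\<phi> v) \<partial>lborel \<partial>lborel)"
    by (subst lborel_pair.nn_integral_snd[symmetric]) (auto simp: case_prod_beta)
  also have "\<dots> = (\<integral>\<^sup>+v. ennreal (?\<phi> v) \<partial>lborel)"
  proof (rule nn_integral_cong)
    fix v
    have "(\<integral>\<^sup>+y. ennreal (q (y + b * v) * ?\<phi> v) \<partial>lborel) = (\<integral>\<^sup>+y. ennreal (q (b * v + 1 * y)) \<partial>lborel) * ennreal (?\<phi> v)"
      by (subst nn_integral_multc[symmetric]) (auto simp: ennreal_mult'' normal_density_nonneg add.commute)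
    also have "(\<integral>\<^sup>+y. ennreal (q (b * v + 1 * y)) \<partial>lborel) = 1"
      using nn_integral_real_affine[of "\<lambda>y. ennreal (q y)" 1 "b * v"] q1 by simp
    finally show "(\<integral>\<^sup>+y. ennreal (q (y + b * v) * ?\<phi> v) \<partial>lborel) = ennreal (?\<phi> v)" by simp
  qed
  finally have Qp: "prob_space Q" using \<phi>1 by (intro prob_spaceI) simp
  have P: "distr (?G \<Otimes>\<^sub>M ?G) (borel \<Otimes>\<^sub>M borel) (?T (x i k)) = density Q (\<rho> i k)" for i k
  proof -
    let ?t = "x i k"
    have "density Q (\<rho> i k) = density ?L (\<lambda>w. ennreal (q (fst w + b * snd w) * ?\<phi> (snd w)) * ennreal (\<rho> i k w))"
      unfolding Q_def \<rho>_def by (subst density_density_eq) auto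
    also have "\<dots> = density ?L (\<lambda>(y, v). ennreal (normal_density ?t (a * \<sigma>) y) * ennreal (?\<phi> v))"
    proof (rule density_cong)
      have "ennreal (q y' * ?\<phi> v) * ennreal (normal_density ?t (a * \<sigma>) y / q y')
         = ennreal (normal_density ?t (a * \<sigma>) y) * ennreal (?\<phi> v)" for y y' v
        using qpos[of y'] by (simp add: ennreal_mult'[symmetric] normal_density_nonneg mult.commute)
      then show "AE w in ?L. ennreal (q (fst w + b * snd w) * ?\<phi> (snd w)) * ennreal (\<rho> i k w) =
        (case w of (y, v) \<Rightarrow> ennreal (normal_density ?t (a * \<sigma>) y) * ennreal (?\<phi> v))"
        by (auto simp: \<rho>_def case_prod_beta)
    qed (auto simp: \<rho>_def)
    also have "\<dots> = density lborel (normal_density ?t (a * \<sigma>)) \<Otimes>\<^sub>M ?G"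
      unfolding gauss_def
      by (subst pair_measure_density)
        (use G.sigma_finite_measure in \<open>auto simp: gauss_def lborel.sigma_finite_measure_axioms\<close>)
    also have "\<dots> = distr ?G lborel (\<lambda>u. ?t + a * u) \<Otimes>\<^sub>M distr ?G ?G (\<lambda>v. v)"
      by (simp add: distr_gauss_affine[OF \<sigma> a] distr_id2)
    also have "\<dots> = distr (?G \<Otimes>\<^sub>M ?G) (lborel \<Otimes>\<^sub>M ?G) (\<lambda>(u, v). (?t + a * u, v))"
      by (rule pair_measure_distr) (auto simp: distr_id2 G.sigma_finite_measure)
    also have "\<dots> = distr (?G \<Otimes>\<^sub>M ?G) (borel \<Otimes>\<^sub>M borel) (?T ?t)"
      by (intro distr_cong) (auto simp: case_prod_beta cong: sets_pair_measure_cong)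
    finally show ?thesis ..
  qed
  have T[measurable]: "?T t \<in> measurable (?G \<Otimes>\<^sub>M ?G) (borel \<Otimes>\<^sub>M borel)" for t
    by (simp add: measurable_cong_sets[OF sGG refl])
  have Pp: "prob_space (density Q (\<rho> i k))" for i k
    unfolding P[symmetric] by (rule GG.prob_space_distr) simp
  have rpos: "\<rho> i k y > 0" for i k y
    using qpos \<sigma> a by (simp add: \<rho>_def normal_density_pos)
  have rm[measurable]: "\<rho> i k \<in> borel_measurable (borel \<Otimes>\<^sub>M borel)" for i k
    unfolding \<rho>_def by measurable
  have lnr: "ln (\<rho> i k (?T (x i k) w)) = - ln a - ln (\<sigma> * sqrt (2 * pi)) - (fst w)\<^sup>2 / (2 * \<sigma>\<^sup>2)
      - ln (q (x i k + (a * fst w + b * snd w)))" for i k w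
  proof -
    have "ln (\<rho> i k (?T (x i k) w)) = ln (normal_density (x i k) (a * \<sigma>) (x i k + a * fst w))
       - ln (q (x i k + (a * fst w + b * snd w)))"
      unfolding \<rho>_def using qpos \<sigma> a
      by (subst ln_div) (auto simp: normal_density_pos add.assoc less_imp_neq[THEN not_sym])
    then show ?thesis using ln_normal_density_affine[OF \<sigma> a] by simp
  qed
  have rot: "distr (?G \<Otimes>\<^sub>M ?G) ?G (\<lambda>(u, v). a * u + b * v) = ?G"
    by (rule distr_gauss_rotate[OF \<sigma> a ab])
  have rotm[measurable]: "(\<lambda>(u, v). a * u + b * v) \<in> measurable (?G \<Otimes>\<^sub>M ?G) ?G"
    by measurable
  have int_q: "integrable (?G \<Otimes>\<^sub>M ?G) (\<lambda>w. ln (q (t + (a * fst w + b * snd w))))"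
    and eq_q: "(\<integral>w. ln (q (t + (a * fst w + b * snd w))) \<partial>(?G \<Otimes>\<^sub>M ?G)) = (\<integral>z. ln (q (t + z)) \<partial>?G)" for t
  proof -
    have "integrable (distr (?G \<Otimes>\<^sub>M ?G) ?G (\<lambda>(u, v). a * u + b * v)) (\<lambda>z. ln (q (t + z)))"
      unfolding rot by (rule qint)
    from integrable_distr[OF rotm this]
    show "integrable (?G \<Otimes>\<^sub>M ?G) (\<lambda>w. ln (q (t + (a * fst w + b * snd w))))"
      by (simp add: case_prod_beta)
    have "(\<integral>z. ln (q (t + z)) \<partial>distr (?G \<Otimes>\<^sub>M ?G) ?G (\<lambda>(u, v). a * u + b * v))
       = (\<integral>w. ln (q (t + (case w of (u, v) \<Rightarrow> a * u + b * v))) \<partial>(?G \<Otimes>\<^sub>M ?G))"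
      by (rule integral_distr[OF rotm]) simp
    then show "(\<integral>w. ln (q (t + (a * fst w + b * snd w))) \<partial>(?G \<Otimes>\<^sub>M ?G)) = (\<integral>z. ln (q (t + z)) \<partial>?G)"
      unfolding rot by (simp add: case_prod_beta)
  qed
  have fstG: "distr (?G \<Otimes>\<^sub>M ?G) ?G fst = ?G" by (rule G.distr_pair_fst)
  have int_f: "integrable (?G \<Otimes>\<^sub>M ?G) (\<lambda>w. (fst w)\<^sup>2)"
    and eq_f: "(\<integral>w. (fst w)\<^sup>2 \<partial>(?G \<Otimes>\<^sub>M ?G)) = \<sigma>\<^sup>2"
  proof -
    have "integrable (distr (?G \<Otimes>\<^sub>M ?G) ?G fst) (\<lambda>z. z\<^sup>2)"
      unfolding fstG using \<sigma> by (rule integrable_gauss_square)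
    from integrable_distr[OF measurable_fst this]
    show "integrable (?G \<Otimes>\<^sub>M ?G) (\<lambda>w. (fst w)\<^sup>2)" .
    have "(\<integral>z. z\<^sup>2 \<partial>distr (?G \<Otimes>\<^sub>M ?G) ?G fst) = (\<integral>w. (fst w)\<^sup>2 \<partial>(?G \<Otimes>\<^sub>M ?G))"
      by (rule integral_distr[OF measurable_fst]) simp
    then show "(\<integral>w. (fst w)\<^sup>2 \<partial>(?G \<Otimes>\<^sub>M ?G)) = \<sigma>\<^sup>2"
      unfolding fstG using integral_gauss_square[OF \<sigma>] by simp
  qed
  have int: "integrable (density Q (\<rho> i k)) (\<lambda>y. ln (\<rho> i k y))" for i k
    unfolding P[symmetric] using int_f int_q
    by (subst integrable_distr_eq) (auto simp: lnr)
  have eq: "(\<integral>y. ln (\<rho> i k y) \<partial>density Q (\<rho> i k))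
     = - 1/2 - ln (\<sigma> * sqrt (2 * pi)) - ln a - (\<integral>z. ln (q (x i k + z)) \<partial>?G)" for i k
    unfolding P[symmetric] using int_f int_q \<sigma>
    by (subst integral_distr) (auto simp: lnr eq_q eq_f GG.prob_space)
  have "measure W {\<omega> \<in> space W. (\<lambda>k\<in>{..<n}. (x i k + a * fst (\<omega> k), snd (\<omega> k))) \<in> B i}
     = measure (PiM {..<n} (\<lambda>k. density Q (\<rho> i k))) (B i)" if "i \<in> I" for i
  proof -
    have "PiM {..<n} (\<lambda>k. density Q (\<rho> i k)) = distr W (PiM {..<n} (\<lambda>_. borel \<Otimes>\<^sub>M borel)) (\<lambda>\<omega>. \<lambda>k\<in>{..<n}. ?T (x i k) (\<omega> k))"
      unfolding P[symmetric] W_def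
      by (rule distr_PiM_componentwise[symmetric]) (auto intro: GG.prob_space_axioms)
    moreover have "(\<lambda>\<omega>. \<lambda>k\<in>{..<n}. ?T (x i k) (\<omega> k)) \<in> measurable W (PiM {..<n} (\<lambda>_. borel \<Otimes>\<^sub>M borel))"
      unfolding W_def by measurable
    ultimately show ?thesis
      using B[OF that] by (simp add: measure_distr) (intro arg_cong[where f="measure W"], auto)
  qed
  then have "(\<Sum>i\<in>I. measure W {\<omega> \<in> space W. (\<lambda>k\<in>{..<n}. (x i k + a * fst (\<omega> k), snd (\<omega> k))) \<in> B i}) * ln (card I)
     = (\<Sum>i\<in>I. measure (PiM {..<n} (\<lambda>k. density Q (\<rho> i k))) (B i)) * ln (card I)"
    by simp
  also have "\<dots> \<le> (\<Sum>i\<in>I. \<Sum>k<n. \<integral>y. ln (\<rho> i k y) \<partial>density Q (\<rho> i k)) + card I"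
    by (rule duality_converse)
      (use I Qp rpos Pp int B disj rm in \<open>auto cong: sets_PiM_cong simp: measurable_cong_sets[OF sQ refl]\<close>)
  finally show ?thesis unfolding eq .
qed

section \<open>The test densities behind the capacity bound\<close>

lemma emeasure_gauss:
  "A \<in> sets borel \<Longrightarrow> emeasure (gauss \<sigma>) A = (\<integral>\<^sup>+z. ennreal (normal_density 0 \<sigma> z) * indicator A z \<partial>lborel)"
  unfolding gauss_def by (subst emeasure_density) auto

lemma gauss_singleton: "measure (gauss \<sigma>) {t} = 0"
proof -
  have "emeasure (gauss \<sigma>) {t} = 0"
    by (subst emeasure_gauss) (auto simp: nn_integral_indicator_singleton)
  then show ?thesis by (simp add: measure_def)
qed

lemma measure_gauss:
  "A \<in> sets borel \<Longrightarrow> measure (gauss \<sigma>) A = (\<integral>z. indicator A z * normal_density 0 \<sigma> z \<partial>lborel)"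
  using integral_gauss[of "indicator A :: real \<Rightarrow> real" \<sigma>] by (simp add: mult.commute)

lemma distr_gauss_uminus:
  assumes "\<sigma> > 0" shows "distr (gauss \<sigma>) (gauss \<sigma>) uminus = gauss \<sigma>"
proof -
  interpret prob_space "gauss \<sigma>" using assms by (intro prob_space_gauss)
  have "distributed (gauss \<sigma>) lborel (\<lambda>u. u) (normal_density 0 \<sigma>)"
    unfolding distributed_def by (auto simp: gauss_def distr_id2)
  from normal_density_affine[OF this assms, of "-1" 0]
  have "distributed (gauss \<sigma>) lborel uminus (normal_density 0 \<sigma>)" by simp
  then have "distr (gauss \<sigma>) lborel uminus = gauss \<sigma>" unfolding distributed_def gauss_def by simp
  then show ?thesis by (simp cong: distr_cong)
qed

lemma Qfun_gauss_atLeast: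
  assumes "\<sigma> > 0" shows "Qfun (t / \<sigma>) = measure (gauss \<sigma>) {t..}"
proof -
  have "distr (gauss 1) lborel (\<lambda>u. 0 + \<sigma> * u) = gauss \<sigma>"
    using distr_gauss_affine[of 1 \<sigma> 0] assms by (simp add: gauss_def)
  then have "measure (gauss \<sigma>) {t..} = measure (distr (gauss 1) lborel (\<lambda>u. 0 + \<sigma> * u)) {t..}" by simp
  also have "\<dots> = measure (gauss 1) ((\<lambda>u. 0 + \<sigma> * u) -` {t..} \<inter> space (gauss 1))"
    by (rule measure_distr) auto
  also have "(\<lambda>u. 0 + \<sigma> * u) -` {t..} \<inter> space (gauss 1) = {t / \<sigma>..}"
    using assms by (auto simp: field_simps)
  also have "measure (gauss 1) {t / \<sigma>..} = Qfun (t / \<sigma>)"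
    by (simp add: measure_gauss Qfun_def set_lebesgue_integral_def normal_density_def)
  finally show ?thesis ..
qed

lemma Qfun_gauss_greaterThan:
  assumes "\<sigma> > 0" shows "Qfun (t / \<sigma>) = measure (gauss \<sigma>) {t<..}"
proof -
  interpret prob_space "gauss \<sigma>" using assms by (intro prob_space_gauss)
  have "prob ({t} \<union> {t<..}) = prob {t} + prob {t<..}"
    by (intro finite_measure_Union) auto
  moreover have "{t} \<union> {t<..} = {t..}" by auto
  ultimately show ?thesis using gauss_singleton Qfun_gauss_atLeast[OF assms] by simp
qed

lemma Qfun_gauss_lessThan:
  assumes "\<sigma> > 0" shows "Qfun (t / \<sigma>) = measure (gauss \<sigma>) {..<- t}"
proof -
  have "measure (gauss \<sigma>) {..<- t} = measure (distr (gauss \<sigma>) (gauss \<sigma>) uminus) {..<- t}"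
    using distr_gauss_uminus[OF assms] by simp
  also have "\<dots> = measure (gauss \<sigma>) (uminus -` {..<- t} \<inter> space (gauss \<sigma>))"
    by (rule measure_distr) auto
  also have "uminus -` {..<- t} \<inter> space (gauss \<sigma>) = {t<..}" by auto
  finally show ?thesis using Qfun_gauss_greaterThan[OF assms] by simp
qed

lemma measure_gauss_interval:
  assumes \<sigma>: "\<sigma> > 0" and "- l \<le> u"
  shows "measure (gauss \<sigma>) {- l..u} = 1 - Qfun (l / \<sigma>) - Qfun (u / \<sigma>)"
proof -
  interpret prob_space "gauss \<sigma>" using \<sigma> by (intro prob_space_gauss)
  have "prob ({..<- l} \<union> ({- l..u} \<union> {u<..})) = prob {..<- l} + (prob {- l..u} + prob {u<..})"
    using assms by (subst finite_measure_Union; (subst finite_measure_Union)?) auto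
  moreover have "{..<- l} \<union> ({- l..u} \<union> {u<..}) = UNIV" using assms by auto
  ultimately show ?thesis
    using Qfun_gauss_lessThan[OF \<sigma>] Qfun_gauss_greaterThan[OF \<sigma>] prob_space by simp
qed

lemma normal_density_antimono:
  assumes "\<sigma> > 0" "0 \<le> t" "t \<le> u" shows "normal_density 0 \<sigma> u \<le> normal_density 0 \<sigma> t"
proof -
  have "t\<^sup>2 \<le> u\<^sup>2" using assms by (intro power_mono) auto
  then show ?thesis using assms
    by (auto simp: normal_density_def intro!: divide_right_mono mult_left_mono)
qed

text \<open>The tail probability is convex on the nonnegative half-line, because its derivative,
  minus the density, increases there; so it lies above its tangents. The proof compares the mass
  between \<open>t\<close> and \<open>u\<close> with a rectangle whose height is the density at
  \<open>t\<close>.\<close>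

lemma Qfun_supporting_line:
  assumes \<sigma>: "\<sigma> > 0" and t: "t \<ge> 0" "u \<ge> 0"
  shows "Qfun (u / \<sigma>) \<ge> Qfun (t / \<sigma>) - normal_density 0 \<sigma> t * (u - t)"
proof -
  interpret prob_space "gauss \<sigma>" using \<sigma> by (intro prob_space_gauss)
  have split: "Qfun (l / \<sigma>) = prob {l..<r} + Qfun (r / \<sigma>)" if "l \<le> r" for l r
  proof -
    have "prob ({l..<r} \<union> {r..}) = prob {l..<r} + prob {r..}"
      by (intro finite_measure_Union) auto
    moreover have "{l..<r} \<union> {r..} = {l..}" using that by auto
    ultimately show ?thesis using Qfun_gauss_atLeast[OF \<sigma>] by simp
  qed
  have const: "(\<integral>z. indicator {l..<r} z * c \<partial>lborel) = c * (r - l)" if "l \<le> r" for l r c :: real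
    using that by simp
  have int: "integrable lborel (\<lambda>z. indicator {l..<r} z * normal_density 0 \<sigma> z)" for l r
    using \<sigma> by (intro integrable_real_mult_indicator[of _ lborel, unfolded mult.commute[of _ "indicator _ _"]]) auto
  have intc: "integrable lborel (\<lambda>z. indicator {l..<r} z * c)" for l r c :: real
    by (intro integrable_mult_left integrable_real_indicator) (cases "l \<le> r"; simp)+
  show ?thesis
  proof (cases "t \<le> u")
    case True
    have "prob {t..<u} \<le> (\<integral>z. indicator {t..<u} z * normal_density 0 \<sigma> t \<partial>lborel)"
      unfolding measure_gauss[of "{t..<u}", simplified]
      using int intc normal_density_antimono[OF \<sigma> t(1)]
      by (intro integral_mono) (auto simp: indicator_def)
    also have "\<dots> = normal_density 0 \<sigma> t * (u - t)" by (rule const[OF True])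
    finally show ?thesis using split[OF True] by simp
  next
    case False
    then have ut: "u \<le> t" by simp
    have "normal_density 0 \<sigma> t * (t - u) = (\<integral>z. indicator {u..<t} z * normal_density 0 \<sigma> t \<partial>lborel)"
      by (rule const[OF ut, symmetric])
    also have "\<dots> \<le> prob {u..<t}"
      unfolding measure_gauss[of "{u..<t}", simplified]
      using int intc normal_density_antimono[OF \<sigma>] t
      by (intro integral_mono) (auto simp: indicator_def)
    finally show ?thesis using split[OF ut] by (simp add: algebra_simps)
  qed
qed

lemma DERIV_normal_density:
  assumes "\<sigma> > 0"
  shows "(normal_density 0 \<sigma> has_real_derivative - (z / \<sigma>\<^sup>2) * normal_density 0 \<sigma> z) (at z)"
  unfolding normal_density_def using assms
  by (auto intro!: derivative_eq_intros simp: field_simps power2_eq_square)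

text \<open>\<open>z\<close> times the density is the derivative of
  \<open>- \<sigma>\<^sup>2\<close> times the density.\<close>

lemma integral_gauss_interval_id:
  assumes \<sigma>: "\<sigma> > 0" and "l \<le> u"
  shows "(\<integral>z. indicator {l..u} z * z \<partial>gauss \<sigma>) = \<sigma>\<^sup>2 * (normal_density 0 \<sigma> l - normal_density 0 \<sigma> u)"
proof -
  have "(\<integral>z. indicator {l..u} z *\<^sub>R (z * normal_density 0 \<sigma> z) \<partial>lborel)
     = (- \<sigma>\<^sup>2 * normal_density 0 \<sigma> u) - (- \<sigma>\<^sup>2 * normal_density 0 \<sigma> l)"
  proof (rule integral_FTC_atLeastAtMost[OF \<open>l \<le> u\<close>])
    fix z
    have "((\<lambda>z. - \<sigma>\<^sup>2 * normal_density 0 \<sigma> z) has_real_derivative z * normal_density 0 \<sigma> z) (at z within {l..u})"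
      by (rule DERIV_subset[where s=UNIV]) (use \<sigma> in \<open>auto intro!: derivative_eq_intros DERIV_normal_density\<close>)
    then show "((\<lambda>z. - \<sigma>\<^sup>2 * normal_density 0 \<sigma> z) has_vector_derivative z * normal_density 0 \<sigma> z) (at z within {l..u})"
      by (simp add: has_real_derivative_iff_has_vector_derivative)
  qed (use \<sigma> in \<open>auto simp: normal_density_def intro!: continuous_intros\<close>)
  then show ?thesis by (subst integral_gauss) (auto simp: algebra_simps)
qed

text \<open>\<open>z\<^sup>2 - \<sigma>\<^sup>2\<close> times the density is the derivative of
  \<open>- \<sigma>\<^sup>2 z\<close> times the density. This settles the middle interval in closed
  form, and the tails follow by subtraction from the full second moment.\<close>

lemma integral_gauss_tails_square:
  assumes \<sigma>: "\<sigma> > 0" and \<xi>: "\<xi> > 0"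
  shows "(\<integral>z. indicator (- {- \<xi>..\<xi>}) z * z\<^sup>2 \<partial>gauss \<sigma>) = 2 * \<sigma>\<^sup>2 * (Qfun (\<xi> / \<sigma>) + \<xi> * normal_density 0 \<sigma> \<xi>)"
proof -
  have sym: "normal_density 0 \<sigma> (- \<xi>) = normal_density 0 \<sigma> \<xi>" by (simp add: normal_density_def)
  have "(\<integral>z. indicator {- \<xi>..\<xi>} z *\<^sub>R ((z\<^sup>2 - \<sigma>\<^sup>2) * normal_density 0 \<sigma> z) \<partial>lborel)
     = (- \<sigma>\<^sup>2 * \<xi> * normal_density 0 \<sigma> \<xi>) - (- \<sigma>\<^sup>2 * (- \<xi>) * normal_density 0 \<sigma> (- \<xi>))"
  proof (rule integral_FTC_atLeastAtMost)
    fix z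
    have "((\<lambda>z. - \<sigma>\<^sup>2 * z * normal_density 0 \<sigma> z) has_real_derivative (z\<^sup>2 - \<sigma>\<^sup>2) * normal_density 0 \<sigma> z) (at z within {- \<xi>..\<xi>})"
      by (rule DERIV_subset[where s=UNIV])
        (use \<sigma> in \<open>auto intro!: derivative_eq_intros DERIV_normal_density simp: algebra_simps power2_eq_square\<close>)
    then show "((\<lambda>z. - \<sigma>\<^sup>2 * z * normal_density 0 \<sigma> z) has_vector_derivative (z\<^sup>2 - \<sigma>\<^sup>2) * normal_density 0 \<sigma> z) (at z within {- \<xi>..\<xi>})"
      by (simp add: has_real_derivative_iff_has_vector_derivative)
  qed (use \<sigma> \<xi> in \<open>auto simp: normal_density_def intro!: continuous_intros\<close>)
  then have 1: "(\<integral>z. indicator {- \<xi>..\<xi>} z * (z\<^sup>2 - \<sigma>\<^sup>2) \<partial>gauss \<sigma>) = - 2 * \<sigma>\<^sup>2 * \<xi> * normal_density 0 \<sigma> \<xi>"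
    by (subst integral_gauss) (auto simp: algebra_simps sym)
  interpret prob_space "gauss \<sigma>" using \<sigma> by (intro prob_space_gauss)
  have i2: "integrable (gauss \<sigma>) (\<lambda>z. indicator {- \<xi>..\<xi>} z * (z\<^sup>2 - \<sigma>\<^sup>2))"
    using integrable_real_mult_indicator[of "{- \<xi>..\<xi>}" "gauss \<sigma>" "\<lambda>z. z\<^sup>2 - \<sigma>\<^sup>2"] integrable_gauss_square[OF \<sigma>]
    by (simp add: mult.commute)
  have i3: "integrable (gauss \<sigma>) (\<lambda>z. indicator {- \<xi>..\<xi>} z * \<sigma>\<^sup>2)"
    by (intro integrable_mult_left integrable_real_indicator) (auto simp: emeasure_eq_measure)
  have "(\<integral>z. indicator (- {- \<xi>..\<xi>}) z * z\<^sup>2 \<partial>gauss \<sigma>)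
     = (\<integral>z. z\<^sup>2 - (indicator {- \<xi>..\<xi>} z * (z\<^sup>2 - \<sigma>\<^sup>2) + indicator {- \<xi>..\<xi>} z * \<sigma>\<^sup>2) \<partial>gauss \<sigma>)"
    by (intro Bochner_Integration.integral_cong) (auto simp: indicator_def)
  also have "\<dots> = \<sigma>\<^sup>2 - (- 2 * \<sigma>\<^sup>2 * \<xi> * normal_density 0 \<sigma> \<xi> + prob {- \<xi>..\<xi>} * \<sigma>\<^sup>2)"
    using i2 i3 integrable_gauss_square[OF \<sigma>] integral_gauss_square[OF \<sigma>]
    by (simp add: 1)
  also have "prob {- \<xi>..\<xi>} = 1 - 2 * Qfun (\<xi> / \<sigma>)"
    using measure_gauss_interval[OF \<sigma>, of \<xi> \<xi>] \<xi> by simp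
  finally show ?thesis by (simp add: algebra_simps)
qed

text \<open>An upper bound \<open>K\<close> (in nats) with Lagrange multiplier \<open>c\<close> for the mean constraint: the left-hand
  side of the last inequality is the divergence of \<open>N(x, \<sigma>\<^sup>2)\<close> from the density \<open>q\<close>.\<close>

definition dual_bound :: "real \<Rightarrow> real \<Rightarrow> real \<Rightarrow> real \<Rightarrow> bool" where
  "dual_bound \<sigma> a m K \<longleftrightarrow> (\<exists>q c. q \<in> borel_measurable borel \<and> (\<forall>y. q y > 0)
     \<and> (\<integral>\<^sup>+y. ennreal (q y) \<partial>lborel) = 1 \<and> (\<forall>x. integrable (gauss \<sigma>) (\<lambda>z. ln (q (x + z)))) \<and> c \<ge> 0
     \<and> (\<forall>x. 0 \<le> x \<longrightarrow> x \<le> a \<longrightarrow>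
          - 1/2 - ln (\<sigma> * sqrt (2 * pi)) - (\<integral>z. ln (q (x + z)) \<partial>gauss \<sigma>) \<le> K + c * (x - m)))"

text \<open>The test density has Gaussian tails beyond \<open>[- \<xi>, a + \<xi>]\<close> and is \<open>\<kappa> exp (- s y)\<close> in between. The
  multiplier comes from the supporting line at \<open>x0\<close> of the concave function \<open>P x\<close>, the probability that
  the output falls into the middle interval.\<close>

lemma mixture_dual_bound:
  assumes \<sigma>: "\<sigma> > 0" and a: "a > 0" and \<xi>: "\<xi> > 0" and s: "s \<ge> 0" and \<kappa>: "\<kappa> > 0"
    and mass: "(\<integral>\<^sup>+y. ennreal (\<kappa> * exp (- s * y)) * indicator {- \<xi>..a + \<xi>} y \<partial>lborel)
        = ennreal (1 - 2 * Qfun (\<xi> / \<sigma>))"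
    and \<kappa>1: "\<kappa> * (\<sigma> * sqrt (2 * pi)) \<le> 1"
    and x0: "0 \<le> x0" "x0 \<le> a / 2" and m: "m = x0 \<or> s = 0 \<and> x0 = a / 2"
  shows "dual_bound \<sigma> a m ((1 - Qfun ((\<xi> + x0) / \<sigma>) - Qfun ((\<xi> + (a - x0)) / \<sigma>)) * ln (1 / (\<kappa> * (\<sigma> * sqrt (2 * pi))))
     + (- 1/2 + Qfun (\<xi> / \<sigma>) + \<xi> * normal_density 0 \<sigma> \<xi>
        + s * \<sigma>\<^sup>2 * (normal_density 0 \<sigma> \<xi> - normal_density 0 \<sigma> (a + \<xi>))
        + s * x0 * (1 - 2 * Qfun ((\<xi> + a / 2) / \<sigma>))))"
proof -
  let ?G = "gauss \<sigma>" and ?\<phi> = "normal_density 0 \<sigma>"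
  interpret G: prob_space ?G using \<sigma> by (rule prob_space_gauss)
  define q where "q = (\<lambda>y. if y < - \<xi> then ?\<phi> y else if y \<le> a + \<xi> then \<kappa> * exp (- s * y) else ?\<phi> (y - a))"
  define S where "S = \<sigma> * sqrt (2 * pi)"
  have S: "S > 0" using \<sigma> by (simp add: S_def)
  have ln\<phi>: "ln (?\<phi> y) = - ln S - y\<^sup>2 / (2 * \<sigma>\<^sup>2)" for y
    using ln_normal_density_affine[OF \<sigma>, of 1 0 y] by (simp add: S_def)
  have q[measurable]: "q \<in> borel_measurable borel" unfolding q_def by measurable
  have qpos: "q y > 0" for y using \<sigma> \<kappa> by (simp add: q_def normal_density_pos)
  have lnq: "ln (q y) = (if y < - \<xi> then - ln S - y\<^sup>2 / (2 * \<sigma>\<^sup>2) else if y \<le> a + \<xi> then ln \<kappa> - s * y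
      else - ln S - (y - a)\<^sup>2 / (2 * \<sigma>\<^sup>2))" for y
    using \<kappa> by (auto simp: q_def ln\<phi> ln_mult)
  have Q0: "Qfun (\<xi> / \<sigma>) \<ge> 0" using Qfun_gauss_atLeast[OF \<sigma>] by simp
  have mid1: "G.prob {- \<xi>..\<xi>} = 1 - 2 * Qfun (\<xi> / \<sigma>)"
    using measure_gauss_interval[OF \<sigma>, of \<xi> \<xi>] \<xi> by simp
  have Q1: "1 - 2 * Qfun (\<xi> / \<sigma>) \<ge> 0" unfolding mid1[symmetric] by simp
  \<comment> \<open>Each tail keeps the Gaussian mass \<open>Qfun (\<xi> / \<sigma>)\<close>, and
    \<open>mass\<close> gives the middle exactly what remains to 1.\<close>
  have "(\<integral>\<^sup>+y. ennreal (q y) \<partial>lborel)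
     = (\<integral>\<^sup>+y. ennreal (?\<phi> y) * indicator {..<- \<xi>} y
        + (ennreal (\<kappa> * exp (- s * y)) * indicator {- \<xi>..a + \<xi>} y
        + ennreal (?\<phi> (y - a)) * indicator {a + \<xi><..} y) \<partial>lborel)"
    using a \<xi> by (intro nn_integral_cong) (auto simp: q_def indicator_def)
  also have "\<dots> = (\<integral>\<^sup>+y. ennreal (?\<phi> y) * indicator {..<- \<xi>} y \<partial>lborel)
        + (ennreal (1 - 2 * Qfun (\<xi> / \<sigma>))
        + (\<integral>\<^sup>+y. ennreal (?\<phi> (y - a)) * indicator {a + \<xi><..} y \<partial>lborel))"
    unfolding mass[symmetric] by (subst nn_integral_add; (subst nn_integral_add)?) auto
  also have "(\<integral>\<^sup>+y. ennreal (?\<phi> y) * indicator {..<- \<xi>} y \<partial>lborel) = ennreal (Qfun (\<xi> / \<sigma>))"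
    using Qfun_gauss_lessThan[OF \<sigma>, of \<xi>] by (simp add: emeasure_gauss[symmetric] G.emeasure_eq_measure)
  also have "(\<integral>\<^sup>+y. ennreal (?\<phi> (y - a)) * indicator {a + \<xi><..} y \<partial>lborel)
     = (\<integral>\<^sup>+y. ennreal (?\<phi> y) * indicator {\<xi><..} y \<partial>lborel)"
    by (subst nn_integral_real_affine[where c=1 and t=a]) (auto intro!: nn_integral_cong simp: indicator_def)
  also have "\<dots> = ennreal (Qfun (\<xi> / \<sigma>))"
    using Qfun_gauss_greaterThan[OF \<sigma>, of \<xi>] by (simp add: emeasure_gauss[symmetric] G.emeasure_eq_measure)
  finally have q1: "(\<integral>\<^sup>+y. ennreal (q y) \<partial>lborel) = 1"
    using Q0 Q1 by (simp add: ennreal_plus[symmetric] del: ennreal_plus)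
  have sq: "integrable ?G (\<lambda>z. z\<^sup>2)" by (rule integrable_gauss_square[OF \<sigma>])
  have qint: "integrable ?G (\<lambda>z. ln (q (x + z)))" for x
  proof -
    \<comment> \<open>Only integrability is at stake, so one crude quadratic majorant for all three
      branches of \<open>q\<close> is enough.\<close>
    define C where "C = \<bar>ln S\<bar> + \<bar>ln \<kappa>\<bar> + s + a\<^sup>2 / \<sigma>\<^sup>2"
    define D where "D = s + 1 / \<sigma>\<^sup>2"
    have bd: "\<bar>ln (q y)\<bar> \<le> C + D * y\<^sup>2" for y
    proof -
      have "y\<^sup>2 / (2 * \<sigma>\<^sup>2) \<le> y\<^sup>2 / \<sigma>\<^sup>2" using \<sigma> by (simp add: field_simps)
      moreover have "(y - a)\<^sup>2 / (2 * \<sigma>\<^sup>2) \<le> (2 * y\<^sup>2 + 2 * a\<^sup>2) / (2 * \<sigma>\<^sup>2)"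
        using \<sigma> sum_squares_ge_zero[of "y + a" 0] by (intro divide_right_mono) (auto simp: power2_eq_square algebra_simps)
      then have "(y - a)\<^sup>2 / (2 * \<sigma>\<^sup>2) \<le> y\<^sup>2 / \<sigma>\<^sup>2 + a\<^sup>2 / \<sigma>\<^sup>2"
        using \<sigma> by (simp add: field_simps)
      moreover have "\<bar>y\<bar> \<le> 1 + y\<^sup>2"
        using sum_squares_ge_zero[of "\<bar>y\<bar> - 1/2" 0] by (auto simp: power2_eq_square algebra_simps)
      then have "\<bar>s * y\<bar> \<le> s + s * y\<^sup>2"
        using s mult_left_mono[of "\<bar>y\<bar>" "1 + y\<^sup>2" s] by (simp add: abs_mult algebra_simps)
      moreover have "0 \<le> y\<^sup>2 / (2 * \<sigma>\<^sup>2)" "0 \<le> (y - a)\<^sup>2 / (2 * \<sigma>\<^sup>2)" "0 \<le> y\<^sup>2 / \<sigma>\<^sup>2" "0 \<le> a\<^sup>2 / \<sigma>\<^sup>2" "0 \<le> s * y\<^sup>2"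
        using s by auto
      moreover have "D * y\<^sup>2 = s * y\<^sup>2 + y\<^sup>2 / \<sigma>\<^sup>2" by (simp add: D_def algebra_simps)
      ultimately show ?thesis
        using s unfolding lnq C_def
        by (cases "y < - \<xi>"; cases "y \<le> a + \<xi>"; simp only: if_True if_False; linarith)
    qed
    have "integrable ?G (\<lambda>z. C + D * (2 * x\<^sup>2 + 2 * z\<^sup>2))" using sq by auto
    then show ?thesis
    proof (rule Bochner_Integration.integrable_bound)
      have "norm (ln (q (x + z))) \<le> norm (C + D * (2 * x\<^sup>2 + 2 * z\<^sup>2))" for z
      proof -
        have "D \<ge> 0" using s by (simp add: D_def)
        moreover have "(x + z)\<^sup>2 \<le> 2 * x\<^sup>2 + 2 * z\<^sup>2"
          using sum_squares_ge_zero[of "x - z" 0] by (simp add: power2_eq_square algebra_simps)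
        ultimately have "D * (x + z)\<^sup>2 \<le> D * (2 * x\<^sup>2 + 2 * z\<^sup>2)" by (rule mult_left_mono[rotated])
        then show ?thesis using bd[of "x + z"] by simp
      qed
      then show "AE z in ?G. norm (ln (q (x + z))) \<le> norm (C + D * (2 * x\<^sup>2 + 2 * z\<^sup>2))" by simp
    qed measurable
  qed
  define l where "l = ln (1 / (\<kappa> * S))"
  have l: "l = - ln \<kappa> - ln S" using \<kappa> S by (simp add: l_def ln_div ln_mult)
  \<comment> \<open>\<open>\<kappa>1\<close> bounds \<open>\<kappa>\<close> by the peak of the
    Gaussian density. The sign of \<open>l\<close> allows the supporting line of \<open>P\<close> to
    be multiplied by \<open>l\<close> and keeps the multiplier nonnegative.\<close>
  have l0: "l \<ge> 0" unfolding l_def using \<kappa> S \<kappa>1 by (intro ln_ge_zero) (simp add: S_def)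
  define P where "P = (\<lambda>x. 1 - Qfun ((\<xi> + x) / \<sigma>) - Qfun ((\<xi> + (a - x)) / \<sigma>))"
  define T where "T = - 1/2 + Qfun (\<xi> / \<sigma>) + \<xi> * ?\<phi> \<xi> + s * \<sigma>\<^sup>2 * (?\<phi> \<xi> - ?\<phi> (a + \<xi>))"
  have Jle: "- 1/2 - ln S - (\<integral>z. ln (q (x + z)) \<partial>?G) \<le> T + P x * (l + s * x)"
    if x: "0 \<le> x" "x \<le> a" for x
  proof -
    let ?M = "{- (\<xi> + x)..\<xi> + (a - x)}"
    let ?T = "- {- \<xi>..\<xi>}"
    \<comment> \<open>In the left tail \<open>x \<ge> 0\<close> makes \<open>x + z\<close> no larger
      than \<open>z\<close> in absolute value, and in the right tail \<open>x \<le> a\<close> does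
      the same for \<open>x + z - a\<close>. Both tail events force \<open>z\<close> outside
      \<open>[- \<xi>, \<xi>]\<close>; enlarging them to \<open>?T\<close> makes the tail term
      independent of \<open>x\<close>.\<close>
    have pt: "- ln (q (x + z)) \<le> ln S + indicator ?M z * (l + s * x) + s * (indicator ?M z * z)
        + 1 / (2 * \<sigma>\<^sup>2) * (indicator ?T z * z\<^sup>2)" for z
    proof -
      consider "x + z < - \<xi>" | "- \<xi> \<le> x + z" "x + z \<le> a + \<xi>" | "x + z > a + \<xi>" by linarith
      then show ?thesis
      proof cases
        case 1
        then have "(x + z)\<^sup>2 \<le> z\<^sup>2" using x \<xi> by (intro abs_le_square_iff[THEN iffD1]) auto
        then have "(x + z)\<^sup>2 / (2 * \<sigma>\<^sup>2) \<le> z\<^sup>2 / (2 * \<sigma>\<^sup>2)" by (intro divide_right_mono) auto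
        then show ?thesis using 1 x \<xi> by (simp add: lnq indicator_def)
      next
        case 2
        then show ?thesis using x a \<xi> \<sigma> by (auto simp: lnq indicator_def l algebra_simps)
      next
        case 3
        then have "(x + z - a)\<^sup>2 \<le> z\<^sup>2" using x \<xi> by (intro abs_le_square_iff[THEN iffD1]) auto
        then have "(x + z - a)\<^sup>2 / (2 * \<sigma>\<^sup>2) \<le> z\<^sup>2 / (2 * \<sigma>\<^sup>2)" by (intro divide_right_mono) auto
        then show ?thesis using 3 x \<xi> a by (simp add: lnq indicator_def)
      qed
    qed
    have iM: "integrable ?G (\<lambda>z. indicator ?M z * (l + s * x))"
      by (intro integrable_mult_left integrable_real_indicator) (auto simp: G.emeasure_eq_measure)
    have iz: "integrable ?G (\<lambda>z. indicator ?M z * z)"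
      by (rule G.integrable_const_bound[where B="\<bar>\<xi> + x\<bar> + \<bar>\<xi> + (a - x)\<bar>"]) (auto simp: indicator_def)
    have iT: "integrable ?G (\<lambda>z. indicator ?T z * z\<^sup>2)"
      using integrable_real_mult_indicator[of ?T ?G "\<lambda>z. z\<^sup>2"] sq by (simp add: mult.commute)
    have "- (\<integral>z. ln (q (x + z)) \<partial>?G) = (\<integral>z. - ln (q (x + z)) \<partial>?G)" by simp
    also have "\<dots> \<le> (\<integral>z. ln S + indicator ?M z * (l + s * x) + s * (indicator ?M z * z)
        + 1 / (2 * \<sigma>\<^sup>2) * (indicator ?T z * z\<^sup>2) \<partial>?G)"
      using qint iM iz iT pt by (intro integral_mono) (auto simp del: mult_eq_0_iff)
    also have "\<dots> = ln S + G.prob ?M * (l + s * x) + s * (\<integral>z. indicator ?M z * z \<partial>?G)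
        + 1 / (2 * \<sigma>\<^sup>2) * (\<integral>z. indicator ?T z * z\<^sup>2 \<partial>?G)"
      using iM iz iT G.prob_space by simp
    also have "1 / (2 * \<sigma>\<^sup>2) * (\<integral>z. indicator ?T z * z\<^sup>2 \<partial>?G) = Qfun (\<xi> / \<sigma>) + \<xi> * ?\<phi> \<xi>"
      unfolding integral_gauss_tails_square[OF \<sigma> \<xi>] using \<sigma> by simp
    also have "G.prob ?M = P x"
      using measure_gauss_interval[OF \<sigma>, of "\<xi> + x" "\<xi> + (a - x)"] x \<xi> by (simp add: P_def)
    also have "(\<integral>z. indicator ?M z * z \<partial>?G) = \<sigma>\<^sup>2 * (?\<phi> (- (\<xi> + x)) - ?\<phi> (\<xi> + (a - x)))"
      using x \<xi> a by (intro integral_gauss_interval_id[OF \<sigma>]) auto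
    also have "?\<phi> (- (\<xi> + x)) = ?\<phi> (\<xi> + x)" by (simp add: normal_density_def power2_eq_square algebra_simps)
    finally have "- (\<integral>z. ln (q (x + z)) \<partial>?G) \<le> ln S + P x * (l + s * x)
        + s * (\<sigma>\<^sup>2 * (?\<phi> (\<xi> + x) - ?\<phi> (\<xi> + (a - x)))) + (Qfun (\<xi> / \<sigma>) + \<xi> * ?\<phi> \<xi>)" .
    \<comment> \<open>By monotonicity of the density the difference is largest at
      \<open>x = 0\<close>, which gives a bound uniform in \<open>x\<close>.\<close>
    moreover have "s * (\<sigma>\<^sup>2 * (?\<phi> (\<xi> + x) - ?\<phi> (\<xi> + (a - x)))) \<le> s * (\<sigma>\<^sup>2 * (?\<phi> \<xi> - ?\<phi> (a + \<xi>)))"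
      using s x \<xi> a normal_density_antimono[OF \<sigma>, of \<xi> "\<xi> + x"]
        normal_density_antimono[OF \<sigma>, of "\<xi> + (a - x)" "a + \<xi>"]
      by (intro mult_left_mono) auto
    ultimately show ?thesis by (simp add: T_def algebra_simps)
  qed
  \<comment> \<open>The derivative of \<open>P\<close> at \<open>x0\<close>; it is nonnegative
    because \<open>x0\<close> lies in the left half of \<open>[0, a]\<close>.\<close>
  define d where "d = ?\<phi> (\<xi> + x0) - ?\<phi> (\<xi> + (a - x0))"
  have d0: "d \<ge> 0" unfolding d_def using normal_density_antimono[OF \<sigma>, of "\<xi> + x0" "\<xi> + (a - x0)"] x0 \<xi> by simp
  have sup: "P x \<le> P y + (?\<phi> (\<xi> + y) - ?\<phi> (\<xi> + (a - y))) * (x - y)"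
    if "0 \<le> x" "x \<le> a" "0 \<le> y" "y \<le> a" for x y
    using Qfun_supporting_line[OF \<sigma>, of "\<xi> + y" "\<xi> + x"]
      Qfun_supporting_line[OF \<sigma>, of "\<xi> + (a - y)" "\<xi> + (a - x)"] that \<xi>
    by (simp add: P_def algebra_simps)
  have Ph: "P (a / 2) = 1 - 2 * Qfun ((\<xi> + a / 2) / \<sigma>)"
    by (simp add: P_def)
  \<comment> \<open>By the symmetry between \<open>x\<close> and \<open>a - x\<close> the supporting
    line at the midpoint is horizontal.\<close>
  have Pmax: "P x \<le> P (a / 2)" if "0 \<le> x" "x \<le> a" for x
    using sup[OF that, of "a / 2"] a by simp
  have "G.prob {- (\<xi> + a / 2)..\<xi> + a / 2} = P (a / 2)"
    using measure_gauss_interval[OF \<sigma>, of "\<xi> + a / 2" "\<xi> + a / 2"] \<xi> a by (simp add: Ph)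
  then have Pnn: "P (a / 2) \<ge> 0" using measure_nonneg by metis
  \<comment> \<open>\<open>P x * l\<close> is bounded by its supporting line, of slope
    \<open>d * l\<close>. In \<open>s * x * P x\<close> the probability is replaced by its maximum,
    which adds the slope \<open>s * P (a / 2)\<close>.\<close>
  define c where "c = d * l + s * P (a / 2)"
  have c0: "c \<ge> 0" unfolding c_def using d0 l0 s Pnn by simp
  have fin: "- 1/2 - ln S - (\<integral>z. ln (q (x + z)) \<partial>?G) \<le> (P x0 * l + (T + s * x0 * P (a / 2))) + c * (x - m)"
    if x: "0 \<le> x" "x \<le> a" for x
  proof -
    have 1: "P x * l \<le> (P x0 + d * (x - x0)) * l"
      using sup[OF x, of x0] x0 a l0 by (intro mult_right_mono) (auto simp: d_def)
    have 2: "s * x * P x \<le> s * x * P (a / 2)"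
      using Pmax[OF x] s x by (intro mult_left_mono) auto
    \<comment> \<open>In the second alternative for \<open>m\<close> the line is horizontal:
      \<open>s = 0\<close>, and \<open>d = 0\<close> at the midpoint. Hence \<open>c = 0\<close> and
      the reference mean drops out.\<close>
    have 3: "c * (x - x0) = c * (x - m)"
    proof (cases "m = x0")
      case False
      then have "s = 0" "x0 = a / 2" using m by auto
      moreover from this have "a - x0 = x0" by simp
      ultimately have "c = 0" by (simp only: c_def d_def) simp
      then show ?thesis by simp
    qed simp
    have 4: "T + P x * (l + s * x) = T + (P x * l + s * x * P x)"
      by (simp add: algebra_simps)
    have 5: "T + ((P x0 + d * (x - x0)) * l + s * x * P (a / 2))
       = P x0 * l + (T + s * x0 * P (a / 2)) + c * (x - x0)"
      by (simp add: c_def algebra_simps)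
    show ?thesis using Jle[OF x] 1 2 4 5 unfolding 3[symmetric] by linarith
  qed
  have "P x0 * l + (T + s * x0 * P (a / 2)) =
    (1 - Qfun ((\<xi> + x0) / \<sigma>) - Qfun ((\<xi> + (a - x0)) / \<sigma>)) * ln (1 / (\<kappa> * (\<sigma> * sqrt (2 * pi))))
     + (- 1/2 + Qfun (\<xi> / \<sigma>) + \<xi> * normal_density 0 \<sigma> \<xi>
        + s * \<sigma>\<^sup>2 * (normal_density 0 \<sigma> \<xi> - normal_density 0 \<sigma> (a + \<xi>))
        + s * x0 * (1 - 2 * Qfun ((\<xi> + a / 2) / \<sigma>)))"
    unfolding Ph unfolding T_def l_def S_def P_def ..
  then show ?thesis
    unfolding dual_bound_def using q qpos q1 qint c0 fin by (intro exI[of _ q] exI[of _ c]) (simp add: S_def)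
qed

section \<open>The two cases of \<open>Cbar\<close> as dual bounds\<close>

lemma Qfun_0: "Qfun 0 = 1 / 2"
  using measure_gauss_interval[of 1 0 0] gauss_singleton[of 1 0] by simp

lemma normal_density_zero_mean: "normal_density 0 \<sigma> z = exp (- (z\<^sup>2) / (2 * \<sigma>\<^sup>2)) / (\<sigma> * sqrt (2 * pi))" if "\<sigma> > 0"
  using that by (simp add: normal_density_def real_sqrt_mult)

text \<open>Two supporting lines: the tangent at \<open>\<xi>\<close> evaluated at 0, and the
  tangent at 0 evaluated at \<open>\<xi>\<close>. The second keeps \<open>\<kappa>\<close> below the
  Gaussian peak in both test densities.\<close>

lemma Qfun_pos_bounds:
  assumes \<sigma>: "\<sigma> > 0" and \<xi>: "\<xi> > 0"
  shows "0 < 1 - 2 * Qfun (\<xi> / \<sigma>)" and "(1 - 2 * Qfun (\<xi> / \<sigma>)) * (\<sigma> * sqrt (2 * pi)) \<le> 2 * \<xi>"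
proof -
  have "normal_density 0 \<sigma> \<xi> * \<xi> > 0" using \<sigma> \<xi> by (simp add: normal_density_pos)
  then show "0 < 1 - 2 * Qfun (\<xi> / \<sigma>)"
    using Qfun_supporting_line[OF \<sigma>, of \<xi> 0] \<xi> by (simp add: Qfun_0)
  have "1 - 2 * Qfun (\<xi> / \<sigma>) \<le> 2 * \<xi> / (\<sigma> * sqrt (2 * pi))"
    using Qfun_supporting_line[OF \<sigma>, of 0 \<xi>] \<xi> by (simp add: Qfun_0 normal_density_zero_mean[OF \<sigma>])
  then show "(1 - 2 * Qfun (\<xi> / \<sigma>)) * (\<sigma> * sqrt (2 * pi)) \<le> 2 * \<xi>"
    using \<sigma> by (simp add: pos_le_divide_eq)
qed

text \<open>Passage from the base-2 expressions of \<open>Cbar\<close> to the nats of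
  \<open>dual_bound\<close>.\<close>

lemma log2_nats: "(p * log 2 L + log 2 (exp 1) * T) * ln 2 = p * ln L + T"
  by (simp add: log_def distrib_right)

text \<open>The middle part is uniform: with \<open>s = 0\<close> and the support point
  \<open>a / 2\<close> the multiplier vanishes, so the bound ignores the mean and holds for every
  \<open>m\<close>.\<close>

lemma dual_bound_c2:
  assumes \<sigma>: "\<sigma> > 0" and a: "a > 0" and \<xi>: "\<xi> > 0"
  shows "dual_bound \<sigma> a m (((1 - 2 * Qfun ((\<xi> + a / 2) / \<sigma>))
         * log 2 ((a + 2 * \<xi>) / (\<sigma> * sqrt (2 * pi) * (1 - 2 * Qfun (\<xi> / \<sigma>))))
       + log 2 (exp 1) *
         (- 1/2 + Qfun (\<xi> / \<sigma>)
          + \<xi> / (sqrt (2 * pi) * \<sigma>) * exp (- (\<xi>^2) / (2 * \<sigma>^2)))) * ln 2)"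
proof -
  note Qb = Qfun_pos_bounds[OF \<sigma> \<xi>]
  define \<kappa> where "\<kappa> = (1 - 2 * Qfun (\<xi> / \<sigma>)) / (a + 2 * \<xi>)"
  have \<kappa>: "\<kappa> > 0" using Qb a \<xi> by (simp add: \<kappa>_def)
  have mass: "(\<integral>\<^sup>+y. ennreal (\<kappa> * exp (- 0 * y)) * indicator {- \<xi>..a + \<xi>} y \<partial>lborel)
      = ennreal (1 - 2 * Qfun (\<xi> / \<sigma>))"
  proof -
    have "(\<integral>\<^sup>+y. ennreal (\<kappa> * exp (- 0 * y)) * indicator {- \<xi>..a + \<xi>} y \<partial>lborel)
      = ennreal \<kappa> * emeasure lborel {- \<xi>..a + \<xi>}"
      by (simp add: nn_integral_cmult_indicator)
    also have "emeasure lborel {- \<xi>..a + \<xi>} = ennreal (a + 2 * \<xi>)"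
      using a \<xi> by (simp add: emeasure_lborel_Icc algebra_simps del: ennreal_plus)
    also have "ennreal \<kappa> * \<dots> = ennreal (\<kappa> * (a + 2 * \<xi>))"
      using a \<xi> \<kappa> by (intro ennreal_mult[symmetric]) auto
    finally show ?thesis using a \<xi> by (simp add: \<kappa>_def)
  qed
  have \<kappa>1: "\<kappa> * (\<sigma> * sqrt (2 * pi)) \<le> 1"
    using Qb(2) a \<xi> by (simp add: \<kappa>_def)
  have eq: "1 / (\<kappa> * (\<sigma> * sqrt (2 * pi))) = (a + 2 * \<xi>) / (\<sigma> * sqrt (2 * pi) * (1 - 2 * Qfun (\<xi> / \<sigma>)))"
    by (simp add: \<kappa>_def mult.commute)
  have nd: "\<xi> * normal_density 0 \<sigma> \<xi> = \<xi> / (sqrt (2 * pi) * \<sigma>) * exp (- (\<xi>^2) / (2 * \<sigma>^2))"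
    using \<sigma> by (simp add: normal_density_zero_mean mult.commute)
  show ?thesis
    using mixture_dual_bound[OF \<sigma> a \<xi> order_refl \<kappa> mass \<kappa>1, of "a / 2" m] a
    unfolding eq nd log2_nats by simp
qed

text \<open>This is \<open>t \<le> sinh t\<close>, proved by monotonicity of the difference. It
  bounds the integral of an exponential over a symmetric interval from below by the length of the
  interval.\<close>

lemma two_mult_le_exp_diff: "2 * t \<le> exp t - exp (- t)" if "t \<ge> 0" for t :: real
proof -
  have "(\<lambda>t. exp t - exp (- t) - 2 * t) 0 \<le> (\<lambda>t. exp t - exp (- t) - 2 * t) t"
  proof (rule DERIV_nonneg_imp_nondecreasing[OF that])
    fix x :: real
    have "exp x + exp (- x) - 2 \<ge> 0"
      using sum_squares_ge_zero[of "exp (x / 2) - exp (- x / 2)" 0]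
      by (simp add: algebra_simps exp_add[symmetric])
    then show "\<exists>y. ((\<lambda>t. exp t - exp (- t) - 2 * t) has_real_derivative y) (at x) \<and> 0 \<le> y"
      by (intro exI[of _ "exp x + exp (- x) - 2"] conjI) (auto intro!: derivative_eq_intros)
  qed
  then show ?thesis by simp
qed

text \<open>The middle part decays at rate \<open>\<mu> / a\<close>, and the supporting line is
  taken at the allowed mean \<open>\<alpha> * a\<close>. That point has to lie in the left half of
  \<open>[0, a]\<close>, which is where \<open>\<alpha> < 1/2\<close> enters.\<close>

lemma dual_bound_c1:
  assumes \<sigma>: "\<sigma> > 0" and a: "a > 0" and \<xi>: "\<xi> > 0" and \<mu>: "\<mu> > 0" and \<alpha>: "0 < \<alpha>" "\<alpha> < 1/2"
  shows "dual_bound \<sigma> a (\<alpha> * a) (((1 - Qfun ((\<xi> + \<alpha> * a) / \<sigma>) - Qfun ((\<xi> + (1 - \<alpha>) * a) / \<sigma>))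
         * log 2 ((a / \<sigma>) * (exp (\<mu> * \<xi> / a) - exp (- \<mu> * (1 + \<xi> / a)))
                  / (sqrt (2 * pi) * \<mu> * (1 - 2 * Qfun (\<xi> / \<sigma>))))
       + log 2 (exp 1) *
         (- 1/2 + Qfun (\<xi> / \<sigma>)
          + \<xi> / (sqrt (2 * pi) * \<sigma>) * exp (- (\<xi>^2) / (2 * \<sigma>^2))
          + (\<sigma> / a) * (\<mu> / sqrt (2 * pi))
              * (exp (- (\<xi>^2) / (2 * \<sigma>^2)) - exp (- ((a + \<xi>)^2) / (2 * \<sigma>^2)))
          + \<mu> * \<alpha> * (1 - 2 * Qfun ((\<xi> + a / 2) / \<sigma>)))) * ln 2)"
proof -
  note Qb = Qfun_pos_bounds[OF \<sigma> \<xi>]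
  define s where "s = \<mu> / a"
  have s: "s > 0" using \<mu> a by (simp add: s_def)
  define E where "E = exp (s * \<xi>) - exp (- s * (a + \<xi>))"
  \<comment> \<open>\<open>E / s\<close> is the integral of \<open>exp (- s y)\<close> over
    \<open>[- \<xi>, a + \<xi>]\<close>; its part over \<open>[- \<xi>, \<xi>]\<close> alone is at
    least \<open>2 * \<xi>\<close>.\<close>
  have "2 * (s * \<xi>) \<le> exp (s * \<xi>) - exp (- (s * \<xi>))"
    using s \<xi> by (intro two_mult_le_exp_diff) auto
  also have "\<dots> \<le> E" using s a by (simp add: E_def)
  finally have E: "2 * \<xi> * s \<le> E" by (simp add: mult_ac)
  have E0: "E > 0" by (rule less_le_trans[OF _ E]) (use s \<xi> in simp)
  define \<kappa> where "\<kappa> = (1 - 2 * Qfun (\<xi> / \<sigma>)) * s / E"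
  have \<kappa>: "\<kappa> > 0" using Qb s E0 by (simp add: \<kappa>_def)
  have mass: "(\<integral>\<^sup>+y. ennreal (\<kappa> * exp (- s * y)) * indicator {- \<xi>..a + \<xi>} y \<partial>lborel)
      = ennreal (1 - 2 * Qfun (\<xi> / \<sigma>))"
  proof -
    have "(\<integral>\<^sup>+y. ennreal (\<kappa> * exp (- s * y)) * indicator {- \<xi>..a + \<xi>} y \<partial>lborel)
      = ennreal (- \<kappa> / s * exp (- s * (a + \<xi>)) - - \<kappa> / s * exp (- s * (- \<xi>)))"
      using a \<xi> \<kappa> s
      by (intro nn_integral_FTC_Icc) (auto intro!: derivative_eq_intros)
    also have "- \<kappa> / s * exp (- s * (a + \<xi>)) - - \<kappa> / s * exp (- s * (- \<xi>)) = \<kappa> / s * E"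
      by (simp add: E_def algebra_simps)
    also have "\<dots> = 1 - 2 * Qfun (\<xi> / \<sigma>)" using s E0 by (simp add: \<kappa>_def)
    finally show ?thesis .
  qed
  have "(1 - 2 * Qfun (\<xi> / \<sigma>)) * (\<sigma> * sqrt (2 * pi)) * s \<le> 2 * \<xi> * s"
    using Qb(2) s by (intro mult_right_mono) auto
  then have \<kappa>1: "\<kappa> * (\<sigma> * sqrt (2 * pi)) \<le> 1"
    using E E0 by (simp add: \<kappa>_def mult_ac)
  have Ed: "E = exp (\<mu> * \<xi> / a) - exp (- \<mu> * (1 + \<xi> / a))"
    using a by (simp add: E_def s_def field_simps)
  have eq: "1 / (\<kappa> * (\<sigma> * sqrt (2 * pi))) = (a / \<sigma>) * (exp (\<mu> * \<xi> / a) - exp (- \<mu> * (1 + \<xi> / a)))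
                  / (sqrt (2 * pi) * \<mu> * (1 - 2 * Qfun (\<xi> / \<sigma>)))"
    unfolding Ed[symmetric] using a \<mu> \<sigma> Qb E0 by (simp add: \<kappa>_def s_def field_simps)
  have nd: "\<xi> * normal_density 0 \<sigma> \<xi> = \<xi> / (sqrt (2 * pi) * \<sigma>) * exp (- (\<xi>^2) / (2 * \<sigma>^2))"
    using \<sigma> by (simp add: normal_density_zero_mean mult.commute)
  have sd: "s * \<sigma>\<^sup>2 * (normal_density 0 \<sigma> \<xi> - normal_density 0 \<sigma> (a + \<xi>)) = (\<sigma> / a) * (\<mu> / sqrt (2 * pi))
              * (exp (- (\<xi>^2) / (2 * \<sigma>^2)) - exp (- ((a + \<xi>)^2) / (2 * \<sigma>^2)))"
    unfolding normal_density_zero_mean[OF \<sigma>] diff_divide_distrib[symmetric] s_def using \<sigma> a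
    by (simp add: power2_eq_square)
  have sx: "s * (\<alpha> * a) = \<mu> * \<alpha>" using a by (simp add: s_def)
  have ax: "a - \<alpha> * a = (1 - \<alpha>) * a" by (simp add: algebra_simps)
  have "\<alpha> * a \<le> a / 2" using \<alpha> a by simp
  then show ?thesis
    using mixture_dual_bound[OF \<sigma> a \<xi> less_imp_le[OF s] \<kappa> mass \<kappa>1, of "\<alpha> * a" "\<alpha> * a"] a \<alpha>
    unfolding eq nd sd sx ax log2_nats by simp
qed

text \<open>Every admissible parameter yields a dual bound, so a rate below all of them is below the
  infimum. The slack \<open>t\<close>, in nats, is either zero or the entropy shift of the noise
  reduction.\<close>

lemma le_Cbar:
  assumes \<sigma>: "\<sigma> > 0" and a: "a > 0" and \<alpha>: "0 < \<alpha>"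
    and r: "\<And>K. dual_bound \<sigma> a (\<alpha> * a) K \<Longrightarrow> r * ln 2 \<le> K + t"
  shows "r \<le> Cbar a \<alpha> \<sigma> + t / ln 2"
proof -
  have conv: "r - t / ln 2 \<le> K" if "dual_bound \<sigma> a (\<alpha> * a) (K * ln 2)" for K
    using r[OF that] by (simp add: field_simps)
  have "r - t / ln 2 \<le> Cbar a \<alpha> \<sigma>"
  proof (cases "\<alpha> < 1/2")
    case True
    have ne: "{p :: real \<times> real. fst p > 0 \<and> snd p > 0} \<noteq> {}"
      by (auto intro!: exI[of _ 1])
    show ?thesis
      unfolding Cbar_def if_P[OF True] c1_bound_def Let_def
      by (rule cINF_greatest[OF ne], rule conv, rule dual_bound_c1) (use \<sigma> a \<alpha> True in auto)
  next
    case False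
    show ?thesis
      unfolding Cbar_def if_not_P[OF False] c2_bound_def
      by (rule cINF_greatest, simp, rule conv, rule dual_bound_c2) (use \<sigma> a in auto)
  qed
  then show ?thesis by simp
qed

section \<open>Converse for block codes\<close>

text \<open>After division by \<open>n\<close> the remainder 1 of the Fano-type bound vanishes in
  the limit. \<open>M\<close> stays abstract so that it can be one message count or the product of
  two.\<close>

lemma rate_limit:
  fixes e :: "nat \<Rightarrow> real"
  assumes e: "e \<longlonglongrightarrow> 0" and R: "R \<ge> 0" and M: "\<And>n. 2 powr (real n * R) \<le> M n"
    and le: "\<And>n. (1 - e n) * ln (M n) \<le> real n * K + 1"
  shows "R * ln 2 \<le> K"
proof -
  have "(\<lambda>n. (1 - e n) * (R * ln 2)) \<longlonglongrightarrow> (1 - 0) * (R * ln 2)"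
    by (intro tendsto_intros e)
  moreover have "(\<lambda>n. K + 1 / real n) \<longlonglongrightarrow> K + 0"
    by (intro tendsto_intros lim_1_over_n)
  moreover have "\<forall>\<^sub>F n in sequentially. (1 - e n) * (R * ln 2) \<le> K + 1 / real n"
  proof -
    \<comment> \<open>The lower bound on \<open>M n\<close> is multiplied by \<open>1 - e n\<close>,
      which is nonnegative only from some \<open>n\<close> on.\<close>
    have "\<forall>\<^sub>F n in sequentially. e n < 1" using e by (rule order_tendstoD) simp
    with eventually_gt_at_top[of 0] show ?thesis
    proof eventually_elim
      case (elim n)
      have "real n * R * ln 2 = ln (2 powr (real n * R))" by (simp add: ln_powr)
      also have "\<dots> \<le> ln (M n)" using M[of n]
        by (intro ln_mono) (auto intro: less_le_trans[OF _ M[of n]])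
      finally have "(1 - e n) * (real n * R * ln 2) \<le> (1 - e n) * ln (M n)"
        using elim by (intro mult_left_mono) auto
      also have "\<dots> \<le> real n * K + 1" by (rule le)
      finally have "real n * ((1 - e n) * (R * ln 2)) \<le> real n * (K + 1 / real n)"
        using elim by (simp add: algebra_simps)
      then show ?case using elim by (simp add: mult_le_cancel_left_pos)
    qed
  qed
  ultimately show ?thesis by (auto dest: tendsto_le[OF sequentially_bot])
qed

section \<open>Error events on the space of noise pairs\<close>

lemma noise_eq_gauss: "noise n \<sigma> = PiM {..<n} (\<lambda>_. gauss \<sigma>)"
  by (simp add: noise_def gauss_def)

abbreviation noise_pair :: "nat \<Rightarrow> real \<Rightarrow> (nat \<Rightarrow> real \<times> real) measure" where
  "noise_pair n \<sigma> \<equiv> PiM {..<n} (\<lambda>_. gauss \<sigma> \<Otimes>\<^sub>M gauss \<sigma>)"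

lemma prob_space_noise_pair: "\<sigma> > 0 \<Longrightarrow> prob_space (noise_pair n \<sigma>)"
  by (intro prob_space_PiM prob_space_pair prob_space_gauss)

lemma dec_ok_measurable:
  assumes "dec_ok n g" and "\<And>k. k < n \<Longrightarrow> (\<lambda>\<omega>. y \<omega> k) \<in> borel_measurable M"
  shows "(\<lambda>\<omega>. g (\<lambda>k\<in>{..<n}. y \<omega> k)) \<in> measurable M (count_space UNIV)"
proof -
  have "(\<lambda>\<omega>. \<lambda>k\<in>{..<n}. y \<omega> k) \<in> measurable M (PiM {..<n} (\<lambda>_. borel))"
    using assms(2) by (intro measurable_restrict) auto
  from measurable_compose[OF this assms(1)[unfolded dec_ok_def]] show ?thesis .
qed

text \<open>Moves an error event of the model to the space of noise pairs, where the events of both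
  receivers live together and a union bound makes sense.\<close>

lemma measure_noise_rotate:
  assumes \<sigma>: "\<sigma> > 0" and a: "a > 0" and ab: "a\<^sup>2 + b\<^sup>2 = 1" and g: "dec_ok n g"
  shows "measure (noise n \<sigma>) {z \<in> space (noise n \<sigma>). g (\<lambda>k\<in>{..<n}. t k + z k) \<noteq> m}
    = measure (noise_pair n \<sigma>) {\<omega> \<in> space (noise_pair n \<sigma>).
        g (\<lambda>k\<in>{..<n}. t k + (a * fst (\<omega> k) + b * snd (\<omega> k))) \<noteq> m}"
proof -
  let ?G = "gauss \<sigma>" and ?W = "noise_pair n \<sigma>"
  let ?T = "\<lambda>\<omega>. \<lambda>k\<in>{..<n}. (case \<omega> k of (u, v) \<Rightarrow> a * u + b * v)"
  have "distr ?W (PiM {..<n} (\<lambda>_. ?G)) ?T = PiM {..<n} (\<lambda>_. distr (?G \<Otimes>\<^sub>M ?G) ?G (\<lambda>(u, v). a * u + b * v))"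
    by (rule distr_PiM_componentwise) (auto intro!: prob_space_pair prob_space_gauss \<sigma>)
  then have d: "distr ?W (noise n \<sigma>) ?T = noise n \<sigma>"
    unfolding distr_gauss_rotate[OF \<sigma> a ab] noise_eq_gauss .
  have T: "?T \<in> measurable ?W (noise n \<sigma>)"
    unfolding noise_eq_gauss by measurable
  have gm: "(\<lambda>z. g (\<lambda>k\<in>{..<n}. t k + z k)) \<in> measurable (noise n \<sigma>) (count_space UNIV)"
    unfolding noise_eq_gauss by (intro dec_ok_measurable[OF g]) measurable
  let ?E = "{z \<in> space (noise n \<sigma>). g (\<lambda>k\<in>{..<n}. t k + z k) \<noteq> m}"
  have E: "?E \<in> sets (noise n \<sigma>)" using gm by measurable
  have "measure (noise n \<sigma>) ?E = measure (distr ?W (noise n \<sigma>) ?T) ?E" by (simp only: d)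
  also have "\<dots> = measure ?W (?T -` ?E \<inter> space ?W)" by (rule measure_distr[OF T E])
  also have "?T -` ?E \<inter> space ?W = {\<omega> \<in> space ?W.
        g (\<lambda>k\<in>{..<n}. t k + (a * fst (\<omega> k) + b * snd (\<omega> k))) \<noteq> m}"
  proof -
    have "(\<lambda>k\<in>{..<n}. t k + ?T \<omega> k) = (\<lambda>k\<in>{..<n}. t k + (a * fst (\<omega> k) + b * snd (\<omega> k)))" for \<omega>
      by (auto simp: restrict_def case_prod_beta)
    then show ?thesis using measurable_space[OF T] by auto
  qed
  finally show ?thesis .
qed

text \<open>The multiplier terms of one codeword add up to \<open>c\<close> times the excess of its
  sum over \<open>n * m\<close>, which the mean constraint makes nonpositive.\<close>

lemma dual_bound_converse:
  fixes x :: "'i \<Rightarrow> nat \<Rightarrow> real"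
  assumes K: "dual_bound \<sigma> P m K" and \<sigma>: "\<sigma> > 0" and a: "a > 0" and ab: "a\<^sup>2 + b\<^sup>2 = 1"
    and I: "finite I" "I \<noteq> {}"
    and peak: "\<And>i k. i \<in> I \<Longrightarrow> k < n \<Longrightarrow> 0 \<le> x i k \<and> x i k \<le> P"
    and avg: "\<And>i. i \<in> I \<Longrightarrow> (\<Sum>k<n. x i k) \<le> real n * m"
    and B: "\<And>i. i \<in> I \<Longrightarrow> B i \<in> sets (PiM {..<n} (\<lambda>_. borel \<Otimes>\<^sub>M borel))"
    and disj: "disjoint_family_on B I"
  shows "(\<Sum>i\<in>I. measure (noise_pair n \<sigma>) {\<omega> \<in> space (noise_pair n \<sigma>).
        (\<lambda>k\<in>{..<n}. (x i k + a * fst (\<omega> k), snd (\<omega> k))) \<in> B i}) * ln (card I)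
    \<le> card I * (real n * (K - ln a) + 1)"
proof -
  obtain q c where q: "q \<in> borel_measurable borel" "\<And>y. q y > 0" "(\<integral>\<^sup>+y. ennreal (q y) \<partial>lborel) = 1"
      "\<And>x. integrable (gauss \<sigma>) (\<lambda>z. ln (q (x + z)))" and c: "c \<ge> 0"
    and J: "\<And>x. 0 \<le> x \<Longrightarrow> x \<le> P \<Longrightarrow>
          - 1/2 - ln (\<sigma> * sqrt (2 * pi)) - (\<integral>z. ln (q (x + z)) \<partial>gauss \<sigma>) \<le> K + c * (x - m)"
    using K unfolding dual_bound_def by blast
  have "(\<Sum>k<n. - 1/2 - ln (\<sigma> * sqrt (2 * pi)) - ln a - (\<integral>z. ln (q (x i k + z)) \<partial>gauss \<sigma>))
      \<le> real n * (K - ln a)" if i: "i \<in> I" for i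
  proof -
    have "(\<Sum>k<n. - 1/2 - ln (\<sigma> * sqrt (2 * pi)) - ln a - (\<integral>z. ln (q (x i k + z)) \<partial>gauss \<sigma>))
      \<le> (\<Sum>k<n. (K - ln a) + c * (x i k - m))"
    proof (rule sum_mono)
      fix k assume "k \<in> {..<n}"
      then show "- 1/2 - ln (\<sigma> * sqrt (2 * pi)) - ln a - (\<integral>z. ln (q (x i k + z)) \<partial>gauss \<sigma>)
        \<le> (K - ln a) + c * (x i k - m)"
        using J[of "x i k"] peak[OF i, of k] by simp
    qed
    also have "\<dots> = real n * (K - ln a) + c * ((\<Sum>k<n. x i k) - real n * m)"
      by (simp add: sum.distrib sum_distrib_left[symmetric] sum_subtractf)
    also have "\<dots> \<le> real n * (K - ln a)"
      using avg[OF i] c by (simp add: mult_nonneg_nonpos)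
    finally show ?thesis .
  qed
  then have "(\<Sum>i\<in>I. \<Sum>k<n. - 1/2 - ln (\<sigma> * sqrt (2 * pi)) - ln a - (\<integral>z. ln (q (x i k + z)) \<partial>gauss \<sigma>))
      \<le> card I * (real n * (K - ln a))"
    using sum_mono[of I _ "\<lambda>_. real n * (K - ln a)"] by simp
  moreover note gaussian_pair_converse[OF \<sigma> a ab I q B disj, where x=x]
  ultimately show ?thesis by (simp add: distrib_left)
qed

text \<open>The case \<open>a = 1\<close>, \<open>b = 0\<close>. The offset \<open>t\<close> is
  known to the receiver: it is added inside the decoding regions and does not count towards the
  input constraints.\<close>

lemma single_user_converse:
  fixes x :: "nat \<Rightarrow> nat \<Rightarrow> real"
  assumes K: "dual_bound \<sigma> P m K" and \<sigma>: "\<sigma> > 0" and M: "M > 0"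
    and peak: "\<And>i k. i \<in> {1..M} \<Longrightarrow> k < n \<Longrightarrow> 0 \<le> x i k \<and> x i k \<le> P"
    and avg: "\<And>i. i \<in> {1..M} \<Longrightarrow> (\<Sum>k<n. x i k) \<le> real n * m"
    and g: "dec_ok n g"
  shows "(1 - (\<Sum>i\<in>{1..M}. measure (noise n \<sigma>) {z \<in> space (noise n \<sigma>). g (\<lambda>k\<in>{..<n}. x i k + t k + z k) \<noteq> i}) / real M)
      * ln M \<le> real n * K + 1"
proof -
  let ?W = "noise_pair n \<sigma>" and ?Y = "PiM {..<n} (\<lambda>_. borel \<Otimes>\<^sub>M borel) :: (nat \<Rightarrow> real \<times> real) measure"
  interpret W: prob_space ?W using \<sigma> by (rule prob_space_noise_pair)
  define B where "B = (\<lambda>i. {y \<in> space ?Y. g (\<lambda>k\<in>{..<n}. fst (y k) + t k) = i})"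
  define p where "p = (\<lambda>i. measure (noise n \<sigma>) {z \<in> space (noise n \<sigma>). g (\<lambda>k\<in>{..<n}. x i k + t k + z k) \<noteq> i})"
  have B: "B i \<in> sets ?Y" for i
  proof -
    have "(\<lambda>y. g (\<lambda>k\<in>{..<n}. fst (y k) + t k)) \<in> measurable ?Y (count_space UNIV)"
      by (intro dec_ok_measurable[OF g]) measurable
    then show ?thesis unfolding B_def by measurable
  qed
  have "measure ?W {\<omega> \<in> space ?W. (\<lambda>k\<in>{..<n}. (x i k + 1 * fst (\<omega> k), snd (\<omega> k))) \<in> B i} = 1 - p i" for i
  proof -
    let ?E = "{\<omega> \<in> space ?W. g (\<lambda>k\<in>{..<n}. x i k + t k + (1 * fst (\<omega> k) + 0 * snd (\<omega> k))) \<noteq> i}"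
    have "(\<lambda>\<omega>. g (\<lambda>k\<in>{..<n}. x i k + t k + (1 * fst (\<omega> k) + 0 * snd (\<omega> k)))) \<in> measurable ?W (count_space UNIV)"
      by (intro dec_ok_measurable[OF g]) measurable
    then have E: "?E \<in> sets ?W" by measurable
    have "{\<omega> \<in> space ?W. (\<lambda>k\<in>{..<n}. (x i k + 1 * fst (\<omega> k), snd (\<omega> k))) \<in> B i} = space ?W - ?E"
    proof -
      have "(\<lambda>k\<in>{..<n}. fst ((\<lambda>k\<in>{..<n}. (x i k + 1 * fst (\<omega> k), snd (\<omega> k))) k) + t k)
         = (\<lambda>k\<in>{..<n}. x i k + t k + (1 * fst (\<omega> k) + 0 * snd (\<omega> k)))" for \<omega> :: "nat \<Rightarrow> real \<times> real"
        by (auto simp: restrict_def)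
      then show ?thesis by (auto simp: B_def space_PiM space_pair_measure)
    qed
    then have "measure ?W {\<omega> \<in> space ?W. (\<lambda>k\<in>{..<n}. (x i k + 1 * fst (\<omega> k), snd (\<omega> k))) \<in> B i} = 1 - measure ?W ?E"
      using W.prob_compl[OF E] by simp
    also have "measure ?W ?E = p i"
      unfolding p_def using measure_noise_rotate[OF \<sigma> _ _ g, of 1 0 "\<lambda>k. x i k + t k" i] by simp
    finally show ?thesis .
  qed
  moreover have "disjoint_family_on B {1..M}" by (auto simp: disjoint_family_on_def B_def)
  ultimately have "(\<Sum>i\<in>{1..M}. 1 - p i) * ln (card {1..M}) \<le> card {1..M} * (real n * (K - ln 1) + 1)"
    using dual_bound_converse[OF K \<sigma> zero_less_one, of 0 "{1..M}" n x B] peak avg B M by simp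
  then have "(real M - (\<Sum>i\<in>{1..M}. p i)) * ln M \<le> real M * (real n * K + 1)"
    by (simp add: sum_subtractf)
  moreover have "real M - (\<Sum>i\<in>{1..M}. p i) = real M * (1 - (\<Sum>i\<in>{1..M}. p i) / real M)"
    using M by (simp add: field_simps)
  ultimately have "real M * ((1 - (\<Sum>i\<in>{1..M}. p i) / real M) * ln M) \<le> real M * (real n * K + 1)"
    by (simp only: mult.assoc)
  then show ?thesis using M by (simp add: p_def)
qed

text \<open>A receiver that sees \<open>(h11 X1 + h21 X2 + a U, V)\<close> recovers both messages: adding \<open>b V\<close> gives the first
  user's channel output; after subtraction of \<open>h11 X1\<close>, scaling by \<open>c / a\<close> and addition of \<open>h12 X1 + d V\<close>
  it holds the second user's channel output.\<close>

lemma sum_converse: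
  assumes K: "dual_bound \<sigma> (h11 * A + h21 * A) (h11 * \<alpha>1 * A + h21 * \<alpha>2 * A) K" and \<sigma>: "\<sigma> > 0"
    and h: "h11 \<ge> 0" "h21 \<ge> 0" and M: "M1 > 0" "M2 > 0"
    and f1: "enc_ok n M1 A \<alpha>1 f1" and f2: "enc_ok n M2 A \<alpha>2 f2"
    and g1: "dec_ok n g1" and g2: "dec_ok n g2"
    and a: "a > 0" and ab: "a\<^sup>2 + b\<^sup>2 = 1" and c: "c > 0" and cd: "c\<^sup>2 + d\<^sup>2 = 1"
    and ca: "c * h21 = a * h22"
  shows "(1 - (err_prob n \<sigma> M1 M2 h11 h21 f1 f2 g1 + err_prob n \<sigma> M2 M1 h22 h12 f2 f1 g2)) * ln (real M1 * real M2)
    \<le> real n * (K - ln a) + 1"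
proof -
  let ?W = "noise_pair n \<sigma>" and ?Y = "PiM {..<n} (\<lambda>_. borel \<Otimes>\<^sub>M borel) :: (nat \<Rightarrow> real \<times> real) measure"
  interpret W: prob_space ?W using \<sigma> by (rule prob_space_noise_pair)
  let ?I = "{1..M1} \<times> {1..M2}"
  define x where "x = (\<lambda>(m, m') k. h11 * f1 m k + h21 * f2 m' k)"
  define D1 where "D1 = (\<lambda>y. g1 (\<lambda>k\<in>{..<n}. fst (y k) + b * snd (y k)))"
  define D2 where "D2 = (\<lambda>m y. g2 (\<lambda>k\<in>{..<n}. h12 * f1 m k + c / a * (fst (y k) - h11 * f1 m k) + d * snd (y k)))"
  define B where "B = (\<lambda>(m, m'). {y \<in> space ?Y. D1 y = m \<and> D2 m y = m'})"
  define p1 where "p1 = (\<lambda>m m'. measure (noise n \<sigma>)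
          {z \<in> space (noise n \<sigma>). g1 (\<lambda>k\<in>{..<n}. h11 * f1 m k + h21 * f2 m' k + z k) \<noteq> m})"
  define p2 where "p2 = (\<lambda>m' m. measure (noise n \<sigma>)
          {z \<in> space (noise n \<sigma>). g2 (\<lambda>k\<in>{..<n}. h22 * f2 m' k + h12 * f1 m k + z k) \<noteq> m'})"
  have D1m: "D1 \<in> measurable ?Y (count_space UNIV)"
    unfolding D1_def by (intro dec_ok_measurable[OF g1]) measurable
  have D2m: "D2 m \<in> measurable ?Y (count_space UNIV)" for m
    unfolding D2_def by (intro dec_ok_measurable[OF g2]) measurable
  have B: "B i \<in> sets ?Y" for i
    using D1m D2m[of "fst i"] unfolding B_def case_prod_beta by measurable
  \<comment> \<open>Although \<open>D2\<close> uses the message \<open>m\<close>, the observation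
    \<open>y\<close> fixes \<open>m\<close> through \<open>D1\<close> and then \<open>m'\<close>
    through \<open>D2 m\<close>, so it lies in at most one region.\<close>
  have disj: "disjoint_family_on B ?I"
    by (auto simp: disjoint_family_on_def B_def)
  have peak: "0 \<le> x i k \<and> x i k \<le> h11 * A + h21 * A" if "i \<in> ?I" "k < n" for i k
    using that f1 f2 h by (auto simp: x_def enc_ok_def intro!: add_mono mult_left_mono add_nonneg_nonneg)
  have avg: "(\<Sum>k<n. x i k) \<le> real n * (h11 * \<alpha>1 * A + h21 * \<alpha>2 * A)" if i0: "i \<in> ?I" for i
  proof -
    obtain m m' where i: "i = (m, m')" "m \<in> {1..M1}" "m' \<in> {1..M2}" using i0 by blast
    have "(\<Sum>k<n. x i k) = h11 * (\<Sum>k<n. f1 m k) + h21 * (\<Sum>k<n. f2 m' k)"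
      by (simp add: x_def i sum.distrib sum_distrib_left)
    also have "\<dots> \<le> h11 * (real n * \<alpha>1 * A) + h21 * (real n * \<alpha>2 * A)"
      using i f1 f2 h by (intro add_mono mult_left_mono) (auto simp: enc_ok_def)
    finally show ?thesis by (simp add: algebra_simps)
  qed
  have each: "1 - p1 m m' - p2 m' m \<le> measure ?W {\<omega> \<in> space ?W. (\<lambda>k\<in>{..<n}. (x (m, m') k + a * fst (\<omega> k), snd (\<omega> k))) \<in> B (m, m')}"
    for m m'
  proof -
    let ?E1 = "{\<omega> \<in> space ?W. g1 (\<lambda>k\<in>{..<n}. h11 * f1 m k + h21 * f2 m' k + (a * fst (\<omega> k) + b * snd (\<omega> k))) \<noteq> m}"
    let ?E2 = "{\<omega> \<in> space ?W. g2 (\<lambda>k\<in>{..<n}. h22 * f2 m' k + h12 * f1 m k + (c * fst (\<omega> k) + d * snd (\<omega> k))) \<noteq> m'}"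
    have "(\<lambda>\<omega>. g1 (\<lambda>k\<in>{..<n}. h11 * f1 m k + h21 * f2 m' k + (a * fst (\<omega> k) + b * snd (\<omega> k)))) \<in> measurable ?W (count_space UNIV)"
      by (intro dec_ok_measurable[OF g1]) measurable
    then have E1: "?E1 \<in> sets ?W" by measurable
    have "(\<lambda>\<omega>. g2 (\<lambda>k\<in>{..<n}. h22 * f2 m' k + h12 * f1 m k + (c * fst (\<omega> k) + d * snd (\<omega> k)))) \<in> measurable ?W (count_space UNIV)"
      by (intro dec_ok_measurable[OF g2]) measurable
    then have E2: "?E2 \<in> sets ?W" by measurable
    have "{\<omega> \<in> space ?W. (\<lambda>k\<in>{..<n}. (x (m, m') k + a * fst (\<omega> k), snd (\<omega> k))) \<in> B (m, m')} = space ?W - (?E1 \<union> ?E2)"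
    proof -
      let ?y = "\<lambda>\<omega>. \<lambda>k\<in>{..<n}. (x (m, m') k + a * fst (\<omega> k), snd (\<omega> k))"
      have "(\<lambda>k\<in>{..<n}. fst (?y \<omega> k) + b * snd (?y \<omega> k))
         = (\<lambda>k\<in>{..<n}. h11 * f1 m k + h21 * f2 m' k + (a * fst (\<omega> k) + b * snd (\<omega> k)))" for \<omega> :: "nat \<Rightarrow> real \<times> real"
        by (auto simp: restrict_def x_def)
      then have 1: "D1 (?y \<omega>) = g1 (\<lambda>k\<in>{..<n}. h11 * f1 m k + h21 * f2 m' k + (a * fst (\<omega> k) + b * snd (\<omega> k)))" for \<omega>
        by (simp only: D1_def)
      \<comment> \<open>Rescaling by \<open>c / a\<close> brings the noise to strength
        \<open>c\<close> and, by \<open>ca\<close>, the second user's gain to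
        \<open>h22\<close>.\<close>
      have "c / a * (h21 * t + a * u) = h22 * t + c * u" for t u
      proof -
        have "c / a * (h21 * t + a * u) = (c * h21) / a * t + c * u" using a by (simp add: field_simps)
        then show ?thesis unfolding ca using a by simp
      qed
      then have "(\<lambda>k\<in>{..<n}. h12 * f1 m k + c / a * (fst (?y \<omega> k) - h11 * f1 m k) + d * snd (?y \<omega> k))
         = (\<lambda>k\<in>{..<n}. h22 * f2 m' k + h12 * f1 m k + (c * fst (\<omega> k) + d * snd (\<omega> k)))" for \<omega> :: "nat \<Rightarrow> real \<times> real"
        by (auto simp: restrict_def x_def add.commute add.left_commute)
      then have 2: "D2 m (?y \<omega>) = g2 (\<lambda>k\<in>{..<n}. h22 * f2 m' k + h12 * f1 m k + (c * fst (\<omega> k) + d * snd (\<omega> k)))" for \<omega>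
        by (simp only: D2_def)
      have "?y \<omega> \<in> space ?Y" for \<omega> by (simp add: space_PiM space_pair_measure)
      then show ?thesis by (auto simp: B_def 1 2)
    qed
    moreover have "measure ?W (space ?W - (?E1 \<union> ?E2)) = 1 - measure ?W (?E1 \<union> ?E2)"
      using E1 E2 by (intro W.prob_compl) auto
    moreover have "measure ?W (?E1 \<union> ?E2) \<le> measure ?W ?E1 + measure ?W ?E2"
      using E1 E2 by (rule measure_Un_le)
    moreover have "measure ?W ?E1 = p1 m m'"
      unfolding p1_def by (rule measure_noise_rotate[OF \<sigma> a ab g1, symmetric])
    moreover have "measure ?W ?E2 = p2 m' m"
      unfolding p2_def by (rule measure_noise_rotate[OF \<sigma> c cd g2, symmetric])
    ultimately show ?thesis by simp
  qed
  define N where "N = real M1 * real M2"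
  have N: "N \<ge> 1" using M mult_mono[of 1 "real M1" 1 "real M2"] by (simp add: N_def)
  have cI: "real (card ?I) = N" by (simp add: N_def)
  have "(\<Sum>(m, m')\<in>?I. 1 - p1 m m' - p2 m' m) \<le> (\<Sum>i\<in>?I. measure ?W {\<omega> \<in> space ?W. (\<lambda>k\<in>{..<n}. (x i k + a * fst (\<omega> k), snd (\<omega> k))) \<in> B i})"
    using each by (intro sum_mono) auto
  then have "(\<Sum>(m, m')\<in>?I. 1 - p1 m m' - p2 m' m) * ln N
     \<le> (\<Sum>i\<in>?I. measure ?W {\<omega> \<in> space ?W. (\<lambda>k\<in>{..<n}. (x i k + a * fst (\<omega> k), snd (\<omega> k))) \<in> B i}) * ln N"
    using N by (intro mult_right_mono) auto
  also have "\<dots> \<le> N * (real n * (K - ln a) + 1)"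
    using dual_bound_converse[OF K \<sigma> a ab, of ?I n x B] peak avg B disj M unfolding cI by force
  finally have 1: "(\<Sum>(m, m')\<in>?I. 1 - p1 m m' - p2 m' m) * ln N \<le> N * (real n * (K - ln a) + 1)" .
  have e1: "(\<Sum>m\<in>{1..M1}. \<Sum>m'\<in>{1..M2}. p1 m m') = N * err_prob n \<sigma> M1 M2 h11 h21 f1 f2 g1"
    using M by (simp add: err_prob_def p1_def N_def)
  have e2: "(\<Sum>m\<in>{1..M1}. \<Sum>m'\<in>{1..M2}. p2 m' m) = N * err_prob n \<sigma> M2 M1 h22 h12 f2 f1 g2"
    using M by (subst sum.swap) (simp add: err_prob_def p2_def N_def)
  have "(\<Sum>(m, m')\<in>?I. 1 - p1 m m' - p2 m' m) = (\<Sum>m\<in>{1..M1}. \<Sum>m'\<in>{1..M2}. 1 - p1 m m' - p2 m' m)"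
    by (simp add: sum.cartesian_product)
  also have "\<dots> = N - N * err_prob n \<sigma> M1 M2 h11 h21 f1 f2 g1 - N * err_prob n \<sigma> M2 M1 h22 h12 f2 f1 g2"
    by (simp add: sum_subtractf e1[symmetric] e2[symmetric]) (simp add: N_def)
  also have "\<dots> = N * (1 - (err_prob n \<sigma> M1 M2 h11 h21 f1 f2 g1 + err_prob n \<sigma> M2 M1 h22 h12 f2 f1 g2))"
    by (simp add: algebra_simps)
  finally have "N * ((1 - (err_prob n \<sigma> M1 M2 h11 h21 f1 f2 g1 + err_prob n \<sigma> M2 M1 h22 h12 f2 f1 g2)) * ln N)
     \<le> N * (real n * (K - ln a) + 1)"
    using 1 by (simp only: mult.assoc)
  then show ?thesis using N unfolding N_def[symmetric] by simp
qed

section \<open>Bounds on achievable rate pairs\<close>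

lemma nmsg_ge: "2 powr (real n * R) \<le> real (nmsg n R)"
  unfolding nmsg_def by (rule of_nat_ceiling)

lemma nmsg_pos: "nmsg n R > 0"
  using nmsg_ge[of n R] powr_gt_zero[of 2 "real n * R"] by (cases "nmsg n R") (auto simp: not_le)

text \<open>The best interfering message does no worse than the average. Fixing it turns the
  interference into a deterministic sequence.\<close>

lemma exists_good_interferer:
  fixes M M' :: nat and p :: "nat \<Rightarrow> nat \<Rightarrow> real"
  assumes "M' > 0"
  obtains m' where "m' \<in> {1..M'}"
    "(\<Sum>m\<in>{1..M}. p m m') / real M \<le> (\<Sum>m\<in>{1..M}. \<Sum>m'\<in>{1..M'}. p m m') / (real M * real M')"
proof -
  define s where "s = (\<lambda>m'. \<Sum>m\<in>{1..M}. p m m')"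
  have "\<exists>m'\<in>{1..M'}. s m' \<le> (\<Sum>m'\<in>{1..M'}. s m') / real M'"
  proof (rule ccontr)
    assume "\<not> ?thesis"
    then have "(\<Sum>m'\<in>{1..M'}. (\<Sum>m'\<in>{1..M'}. s m') / real M') < (\<Sum>m'\<in>{1..M'}. s m')"
      using assms by (intro sum_strict_mono) (auto simp: not_le)
    then show False using assms by simp
  qed
  then obtain m' where m': "m' \<in> {1..M'}" "s m' \<le> (\<Sum>m'\<in>{1..M'}. s m') / real M'" by blast
  have "(\<Sum>m'\<in>{1..M'}. s m') = (\<Sum>m\<in>{1..M}. \<Sum>m'\<in>{1..M'}. p m m')"
    unfolding s_def by (rule sum.swap)
  then have "s m' / real M \<le> (\<Sum>m\<in>{1..M}. \<Sum>m'\<in>{1..M'}. p m m') / real M' / real M"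
    using m'(2) by (intro divide_right_mono) auto
  then show ?thesis using that m'(1) by (simp add: s_def mult.commute)
qed

lemma achievable_swap:
  "achievable h11 h12 h21 h22 \<sigma> A \<alpha>1 \<alpha>2 R1 R2 \<Longrightarrow> achievable h22 h21 h12 h11 \<sigma> A \<alpha>2 \<alpha>1 R2 R1"
  unfolding achievable_def by blast

text \<open>With \<open>\<theta> = 0\<close> the (fixed) interfering codeword is removed by the decoder, with \<open>\<theta> = 1\<close> it is counted as
  part of the channel input.\<close>

lemma achievable_rate_dual_bound:
  assumes ach: "achievable h11 h12 h21 h22 \<sigma> A \<alpha>1 \<alpha>2 R1 R2"
    and \<sigma>: "\<sigma> > 0" and h: "h11 \<ge> 0" "h21 \<ge> 0" and \<theta>: "\<theta> = 0 \<or> \<theta> = 1"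
    and K: "dual_bound \<sigma> (h11 * A + \<theta> * h21 * A) (h11 * \<alpha>1 * A + \<theta> * h21 * \<alpha>2 * A) K"
  shows "R1 * ln 2 \<le> K"
proof -
  obtain f1 f2 g1 where R1: "R1 \<ge> 0"
    and ok: "\<And>n. enc_ok n (nmsg n R1) A \<alpha>1 (f1 n)" "\<And>n. enc_ok n (nmsg n R2) A \<alpha>2 (f2 n)" "\<And>n. dec_ok n (g1 n)"
    and e: "(\<lambda>n. err_prob n \<sigma> (nmsg n R1) (nmsg n R2) h11 h21 (f1 n) (f2 n) (g1 n)) \<longlonglongrightarrow> 0"
    using ach unfolding achievable_def by blast
  show ?thesis
  proof (rule rate_limit[OF e R1 nmsg_ge])
    fix n
    let ?M1 = "nmsg n R1" and ?M2 = "nmsg n R2"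
    let ?p = "\<lambda>m m'. measure (noise n \<sigma>)
          {z \<in> space (noise n \<sigma>). g1 n (\<lambda>k\<in>{..<n}. h11 * f1 n m k + h21 * f2 n m' k + z k) \<noteq> m}"
    obtain m' where m': "m' \<in> {1..?M2}"
      and le: "(\<Sum>m\<in>{1..?M1}. ?p m m') / real ?M1
        \<le> err_prob n \<sigma> ?M1 ?M2 h11 h21 (f1 n) (f2 n) (g1 n)"
      using exists_good_interferer[OF nmsg_pos, of n R2 ?p ?M1] unfolding err_prob_def by blast
    define x where "x = (\<lambda>m k. h11 * f1 n m k + \<theta> * (h21 * f2 n m' k))"
    have f1: "0 \<le> f1 n m k \<and> f1 n m k \<le> A"
      if "m \<in> {1..?M1}" "k < n" for m k
      using ok(1)[of n] that unfolding enc_ok_def by auto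
    have f1a: "(\<Sum>k<n. f1 n m k) \<le> real n * \<alpha>1 * A" if "m \<in> {1..?M1}" for m
      using ok(1)[of n] that unfolding enc_ok_def by auto
    have f2: "0 \<le> f2 n m' k \<and> f2 n m' k \<le> A" if "k < n" for k
      using ok(2)[of n] m' that unfolding enc_ok_def by auto
    have f2a: "(\<Sum>k<n. f2 n m' k) \<le> real n * \<alpha>2 * A"
      using ok(2)[of n] m' unfolding enc_ok_def by auto
    have \<theta>0: "\<theta> \<ge> 0" using \<theta> by auto
    have peak: "0 \<le> x m k \<and> x m k \<le> h11 * A + \<theta> * h21 * A" if "m \<in> {1..?M1}" "k < n" for m k
      using f1[OF that] f2[OF that(2)] h \<theta>0 unfolding x_def mult.assoc
      by (auto intro!: add_mono mult_left_mono add_nonneg_nonneg mult_nonneg_nonneg)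
    have avg: "(\<Sum>k<n. x m k) \<le> real n * (h11 * \<alpha>1 * A + \<theta> * h21 * \<alpha>2 * A)" if "m \<in> {1..?M1}" for m
    proof -
      have "(\<Sum>k<n. x m k) = h11 * (\<Sum>k<n. f1 n m k) + \<theta> * (h21 * (\<Sum>k<n. f2 n m' k))"
        by (simp add: x_def sum.distrib sum_distrib_left)
      also have "\<dots> \<le> h11 * (real n * \<alpha>1 * A) + \<theta> * (h21 * (real n * \<alpha>2 * A))"
        using f1a[OF that] f2a h \<theta>0 by (intro add_mono mult_left_mono) auto
      finally show ?thesis by (simp add: algebra_simps)
    qed
    \<comment> \<open>For either \<open>\<theta>\<close>, input plus known offset is the true
      noiseless output, so the error probabilities are those of the given code.\<close>
    have xe: "x m k + (1 - \<theta>) * (h21 * f2 n m' k) = h11 * f1 n m k + h21 * f2 n m' k" for m k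
      by (simp add: x_def algebra_simps)
    have "(1 - err_prob n \<sigma> ?M1 ?M2 h11 h21 (f1 n) (f2 n) (g1 n)) * ln ?M1
        \<le> (1 - (\<Sum>m\<in>{1..?M1}. ?p m m') / real ?M1) * ln ?M1"
      using le nmsg_pos[of n R1] by (intro mult_right_mono) auto
    also have "\<dots> \<le> real n * K + 1"
      using single_user_converse[OF K \<sigma> nmsg_pos peak avg ok(3), where t = "\<lambda>k. (1 - \<theta>) * (h21 * f2 n m' k)"]
      unfolding xe by simp
    finally show "(1 - err_prob n \<sigma> ?M1 ?M2 h11 h21 (f1 n) (f2 n) (g1 n)) * ln ?M1 \<le> real n * K + 1" .
  qed
qed

lemma achievable_sum_dual_bound:
  assumes ach: "achievable h11 h12 h21 h22 \<sigma> A \<alpha>1 \<alpha>2 R1 R2"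
    and \<sigma>: "\<sigma> > 0" and h: "h11 \<ge> 0" "h21 > 0" "h22 > 0"
    and K: "dual_bound \<sigma> (h11 * A + h21 * A) (h11 * \<alpha>1 * A + h21 * \<alpha>2 * A) K"
  shows "(R1 + R2) * ln 2 \<le> K + max 0 (- ln (h21 / h22))"
proof -
  obtain f1 f2 g1 g2 where R: "R1 \<ge> 0" "R2 \<ge> 0"
    and ok: "\<And>n. enc_ok n (nmsg n R1) A \<alpha>1 (f1 n)" "\<And>n. enc_ok n (nmsg n R2) A \<alpha>2 (f2 n)"
      "\<And>n. dec_ok n (g1 n)" "\<And>n. dec_ok n (g2 n)"
    and e: "(\<lambda>n. err_prob n \<sigma> (nmsg n R1) (nmsg n R2) h11 h21 (f1 n) (f2 n) (g1 n)) \<longlonglongrightarrow> 0"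
      "(\<lambda>n. err_prob n \<sigma> (nmsg n R2) (nmsg n R1) h22 h12 (f2 n) (f1 n) (g2 n)) \<longlonglongrightarrow> 0"
    using ach unfolding achievable_def by blast
  \<comment> \<open>Added noise can only fill up the variance, so \<open>a\<close> and
    \<open>c\<close> must not exceed 1, and they are tied by \<open>c h21 = a h22\<close>. The
    largest such pair has one of them equal to 1; it makes \<open>- ln a\<close> minimal.\<close>
  define a where "a = min 1 (h21 / h22)"
  define c where "c = min 1 (h22 / h21)"
  define b where "b = sqrt (1 - a\<^sup>2)"
  define d where "d = sqrt (1 - c\<^sup>2)"
  have a: "a > 0" "a \<le> 1" and c: "c > 0" "c \<le> 1" using h by (auto simp: a_def c_def)
  have ab: "a\<^sup>2 + b\<^sup>2 = 1" and cd: "c\<^sup>2 + d\<^sup>2 = 1"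
    using a c by (simp_all add: b_def d_def power_le_one)
  have ca: "c * h21 = a * h22"
    using h by (auto simp: a_def c_def min_def field_simps)
  have "- ln a = max 0 (- ln (h21 / h22))"
    using h by (auto simp: a_def min_def max_def ln_div)
  moreover have "(R1 + R2) * ln 2 \<le> K - ln a"
  proof (rule rate_limit)
    show "(\<lambda>n. err_prob n \<sigma> (nmsg n R1) (nmsg n R2) h11 h21 (f1 n) (f2 n) (g1 n)
       + err_prob n \<sigma> (nmsg n R2) (nmsg n R1) h22 h12 (f2 n) (f1 n) (g2 n)) \<longlonglongrightarrow> 0"
      using tendsto_add[OF e] by simp
    show "2 powr (real n * (R1 + R2)) \<le> real (nmsg n R1) * real (nmsg n R2)" for n
      using mult_mono[OF nmsg_ge[of n R1] nmsg_ge[of n R2]] by (simp add: distrib_left powr_add)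
    show "R1 + R2 \<ge> 0" using R by simp
    show "(1 - (err_prob n \<sigma> (nmsg n R1) (nmsg n R2) h11 h21 (f1 n) (f2 n) (g1 n)
       + err_prob n \<sigma> (nmsg n R2) (nmsg n R1) h22 h12 (f2 n) (f1 n) (g2 n))) * ln (real (nmsg n R1) * real (nmsg n R2))
      \<le> real n * (K - ln a) + 1" for n
      using h by (intro sum_converse[OF K \<sigma> _ _ nmsg_pos nmsg_pos ok a(1) ab c(1) cd ca]) auto
  qed
  ultimately show ?thesis by simp
qed

lemma achievable_imp_bounds:
  assumes ach: "achievable h11 h12 h21 h22 \<sigma> A \<alpha>1 \<alpha>2 R1 R2"
    and \<sigma>: "\<sigma> > 0" and A: "A > 0" and \<alpha>: "\<alpha>1 > 0" "\<alpha>2 > 0"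
    and h: "h11 > 0" "h21 \<ge> 0" "h22 > 0"
  defines "\<beta> \<equiv> (h11 * \<alpha>1 + h21 * \<alpha>2) / (h11 + h21)"
  shows "R1 \<le> Cbar (h11 * A) \<alpha>1 \<sigma>"
    and "R1 \<le> Cbar (h11 * A + h21 * A) \<beta> \<sigma>"
    and "h21 > 0 \<Longrightarrow> R1 + R2 \<le> Cbar (h11 * A + h21 * A) \<beta> \<sigma> + max 0 (- log 2 (h21 / h22))"
proof -
  have sA: "h11 * A + h21 * A > 0" using h A by (simp add: add_pos_nonneg)
  have \<beta>: "\<beta> > 0" using h \<alpha> by (simp add: \<beta>_def add_pos_nonneg)
  have \<beta>A: "\<beta> * (h11 * A + h21 * A) = h11 * \<alpha>1 * A + h21 * \<alpha>2 * A"
  proof -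
    have "\<beta> * (h11 * A + h21 * A) = \<beta> * (h11 + h21) * A" by (simp add: algebra_simps)
    also have "\<beta> * (h11 + h21) = h11 * \<alpha>1 + h21 * \<alpha>2" using h by (simp add: \<beta>_def)
    finally show ?thesis by (simp add: algebra_simps)
  qed
  show "R1 \<le> Cbar (h11 * A) \<alpha>1 \<sigma>"
    using le_Cbar[OF \<sigma> _ \<alpha>(1), of "h11 * A" R1 0] achievable_rate_dual_bound[OF ach \<sigma>, of 0] h A
    by (simp add: mult_ac)
  show "R1 \<le> Cbar (h11 * A + h21 * A) \<beta> \<sigma>"
    using le_Cbar[OF \<sigma> sA \<beta>, of R1 0] achievable_rate_dual_bound[OF ach \<sigma>, of 1] h
    unfolding \<beta>A by simp
  assume h21: "h21 > 0"
  have "R1 + R2 \<le> Cbar (h11 * A + h21 * A) \<beta> \<sigma> + max 0 (- ln (h21 / h22)) / ln 2"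
    by (rule le_Cbar[OF \<sigma> sA \<beta>], rule achievable_sum_dual_bound[OF ach \<sigma>]) (use h h21 \<beta>A in auto)
  also have "max 0 (- ln (h21 / h22)) / ln 2 = max 0 (- log 2 (h21 / h22))"
    by (auto simp: log_def max_def divide_le_0_iff zero_le_divide_iff)
  finally show "R1 + R2 \<le> Cbar (h11 * A + h21 * A) \<beta> \<sigma> + max 0 (- log 2 (h21 / h22))" .
qed

text \<open>If \<open>r\<^sup>2\<close> attains the maximum, half its logarithm is
  \<open>log 2 r\<close>, and the noise-reduction bound is exactly the claim. Otherwise half of
  \<open>log 2 w\<close> is at most \<open>- C2\<close>, so the claimed bound is at least
  \<open>C + C2\<close>.\<close>

lemma achievable_sum_bound:
  assumes ach: "achievable h11 h12 h21 h22 \<sigma> A \<alpha>1 \<alpha>2 R1 R2"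
    and \<sigma>: "\<sigma> > 0" and A: "A > 0" and \<alpha>: "\<alpha>1 > 0" "\<alpha>2 > 0"
    and h: "h11 > 0" "h12 \<ge> 0" "h21 \<ge> 0" "h22 > 0"
  shows "R1 + R2 \<le> sum_bound \<sigma> A h11 h21 h22 \<alpha>1 \<alpha>2"
proof -
  define r where "r = h21 / h22"
  define C where "C = Cbar (h11 * A + h21 * A) ((h11 * \<alpha>1 + h21 * \<alpha>2) / (h11 + h21)) \<sigma>"
  define C2 where "C2 = Cbar (h22 * A) \<alpha>2 \<sigma>"
  define w where "w = (1 - r\<^sup>2) / 2 powr (2 * C2)"
  have sb: "sum_bound \<sigma> A h11 h21 h22 \<alpha>1 \<alpha>2 = C - min 0 (1/2 * log 2 (max (r\<^sup>2) w))"
    by (simp add: sum_bound_def C_def C2_def w_def r_def power_divide)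
  note bounds = achievable_imp_bounds[OF ach \<sigma> A \<alpha> h(1,3,4), folded C_def r_def]
  have R2: "R2 \<le> C2"
    using achievable_imp_bounds(1)[OF achievable_swap[OF ach] \<sigma> A \<alpha>(2,1) h(4,2,1)] by (simp add: C2_def)
  have r0: "r \<ge> 0" using h by (simp add: r_def)
  show ?thesis
  proof (cases "w \<le> r\<^sup>2 \<and> r > 0")
    case True
    then have "h21 > 0" using h(4) by (simp add: r_def zero_less_divide_iff)
    then have "R1 + R2 \<le> C + max 0 (- log 2 r)" by (rule bounds(3))
    moreover have "1/2 * log 2 (max (r\<^sup>2) w) = log 2 r"
      using True by (simp add: max_absorb1 log_nat_power)
    ultimately show ?thesis unfolding sb by simp
  next
    case False
    then have w: "w > r\<^sup>2 \<or> r = 0" using r0 by auto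
    \<comment> \<open>Positivity makes \<open>log 2 w\<close> a genuine logarithm. For
      \<open>r = 0\<close> it holds because \<open>w\<close> is then a real power of 2.\<close>
    have w0: "w > 0" using w by (auto simp: w_def intro: le_less_trans[of 0 "r\<^sup>2"])
    then have r1: "1 - r\<^sup>2 > 0" by (simp add: w_def zero_less_divide_iff)
    have "max (r\<^sup>2) w = w" using w w0 by auto
    moreover have "log 2 w = log 2 (1 - r\<^sup>2) - 2 * C2"
      unfolding w_def using r1 by (subst log_divide) auto
    moreover have "log 2 (1 - r\<^sup>2) \<le> 0" using r1 by simp
    ultimately have "min 0 (1/2 * log 2 (max (r\<^sup>2) w)) \<le> - C2" by (simp add: min_le_iff_disj)
    then show ?thesis unfolding sb using bounds(2) R2 by simp
  qed
qed

theorem theorem3: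
  fixes h11 h12 h21 h22 \<sigma> A \<alpha>1 \<alpha>2 :: real
  assumes "\<sigma> > 0" and "A > 0"
    and "\<alpha>1 \<in> {0<..1}" and "\<alpha>2 \<in> {0<..1}"
    and "h11 > 0" and "h22 > 0" and "h12 \<ge> 0" and "h21 \<ge> 0"
  shows "capacity_region h11 h12 h21 h22 \<sigma> A \<alpha>1 \<alpha>2 \<subseteq> GZ' h11 h12 h21 h22 \<sigma> A \<alpha>1 \<alpha>2"
  unfolding capacity_region_def
\<comment> \<open>All constraints of \<open>GZ'\<close> are non-strict with constant right-hand
  sides, so the region is closed and it suffices to treat achievable pairs.\<close>
proof (rule closure_minimal)
  have \<alpha>: "\<alpha>1 > 0" "\<alpha>2 > 0" using assms by auto
  show "{(R1, R2). achievable h11 h12 h21 h22 \<sigma> A \<alpha>1 \<alpha>2 R1 R2} \<subseteq> GZ' h11 h12 h21 h22 \<sigma> A \<alpha>1 \<alpha>2"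
  proof clarify
    fix R1 R2 assume ach: "achievable h11 h12 h21 h22 \<sigma> A \<alpha>1 \<alpha>2 R1 R2"
    note ach' = achievable_swap[OF ach]
    have "R1 \<ge> 0" "R2 \<ge> 0" using ach by (auto simp: achievable_def)
    moreover have "R1 \<le> Cbar (h11 * A) \<alpha>1 \<sigma>" "R1 + R2 \<le> sum_bound \<sigma> A h11 h21 h22 \<alpha>1 \<alpha>2"
      using achievable_imp_bounds(1)[OF ach] achievable_sum_bound[OF ach] assms \<alpha> by auto
    moreover have "R2 \<le> Cbar (h22 * A) \<alpha>2 \<sigma>" "R2 + R1 \<le> sum_bound \<sigma> A h22 h12 h11 \<alpha>2 \<alpha>1"
      using achievable_imp_bounds(1)[OF ach'] achievable_sum_bound[OF ach'] assms \<alpha> by auto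
    ultimately show "(R1, R2) \<in> GZ' h11 h12 h21 h22 \<sigma> A \<alpha>1 \<alpha>2"
      by (simp add: GZ'_def add.commute)
  qed
  show "closed (GZ' h11 h12 h21 h22 \<sigma> A \<alpha>1 \<alpha>2)"
    unfolding GZ'_def case_prod_beta
    by (intro closed_Collect_conj closed_Collect_le continuous_intros)
qed

end
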